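(* Let $n\ge 3$, let $K$ be a field, let $X=(x_{ij})_{1\le i,j\le n}$ and $Y=(y_{ij})_{1\le i,j\le n}$ be matrices of independent indeterminates over $K$, let $R=K[X,Y]$ be the polynomial ring in all these $2n^2$ variables, and let $C=XY-YX=(c_{ij})$. Let $J$ be the ideal of $R$ generated by the anti-diagonal entries $c_{i,n+1-i}$ ($1\le i\le n$) of $C$. Then $R/J$ is a complete intersection ring of dimension $2n^2-n$.
   Context: Dimension means Krull dimension. "$R/J$ is a complete intersection" means that the ideal $J$ is generated by a regular sequence in $R$. *)

theory Defs
  imports
    "HOL-Library.Poly_Mapping"
    "HOL-Library.Extended_Real"
    "HOL-Algebra.QuotRing"
    "HOL-Algebra.Algebraic_Closure_Type"
    "Jordan_Normal_Form.Matrix"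
begin

section \<open>Polynomial rings\<close>

text \<open>
  A monomial is a finitely supported exponent function on the indeterminates, and a polynomial is a
  finitely supported function from monomials to coefficients; multiplication on
  \<^typ>\<open>('v \<Rightarrow>\<^sub>0 nat) \<Rightarrow>\<^sub>0 'k::field\<close> is convolution.
\<close>

definition indet_poly :: "'v \<Rightarrow> ('v \<Rightarrow>\<^sub>0 nat) \<Rightarrow>\<^sub>0 'k::field" where
  "indet_poly v = Poly_Mapping.single (Poly_Mapping.single v 1) 1"

definition mpoly_ring :: "'v set \<Rightarrow> (('v \<Rightarrow>\<^sub>0 nat) \<Rightarrow>\<^sub>0 'k::field) ring" where
  "mpoly_ring V =
     ring_of_type_algebra\<lparr>carrier := {p. \<forall>m \<in> Poly_Mapping.keys p. Poly_Mapping.keys m \<subseteq> V}\<rparr>"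

lemma carrier_mpoly_ring:
  "carrier (mpoly_ring V) = {p. \<forall>m \<in> Poly_Mapping.keys p. Poly_Mapping.keys m \<subseteq> V}"
  by (simp add: mpoly_ring_def)

lemma mpoly_ring_simps [simp]:
  "x \<otimes>\<^bsub>mpoly_ring V\<^esub> y = x * y" "x \<oplus>\<^bsub>mpoly_ring V\<^esub> y = x + y"
  "\<one>\<^bsub>mpoly_ring V\<^esub> = 1" "\<zero>\<^bsub>mpoly_ring V\<^esub> = 0"
  by (simp_all add: mpoly_ring_def ring_of_type_algebra_def)

lemma indet_poly_in_mpoly_ring: "v \<in> V \<Longrightarrow> indet_poly v \<in> carrier (mpoly_ring V)"
  by (auto simp: carrier_mpoly_ring indet_poly_def)

lemma cring_mpoly_ring: "cring (mpoly_ring V)"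
proof -
  have add: "x + y \<in> carrier (mpoly_ring V)"
    if "x \<in> carrier (mpoly_ring V)" "y \<in> carrier (mpoly_ring V)" for x y :: "('a \<Rightarrow>\<^sub>0 nat) \<Rightarrow>\<^sub>0 'b"
    using that Poly_Mapping.keys_add[of x y] unfolding carrier_mpoly_ring by blast
  have mult: "x * y \<in> carrier (mpoly_ring V)"
    if xy: "x \<in> carrier (mpoly_ring V)" "y \<in> carrier (mpoly_ring V)"
    for x y :: "('a \<Rightarrow>\<^sub>0 nat) \<Rightarrow>\<^sub>0 'b"
    unfolding carrier_mpoly_ring
  proof (intro CollectI ballI)
    fix m assume "m \<in> Poly_Mapping.keys (x * y)"
    then obtain a b where "a \<in> Poly_Mapping.keys x" "b \<in> Poly_Mapping.keys y" "m = a + b"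
      using Poly_Mapping.keys_mult[of x y] by blast
    with xy show "Poly_Mapping.keys m \<subseteq> V"
      using Poly_Mapping.keys_add[of a b] unfolding carrier_mpoly_ring by blast
  qed
  have minus: "- x \<in> carrier (mpoly_ring V)"
    if "x \<in> carrier (mpoly_ring V)" for x :: "('a \<Rightarrow>\<^sub>0 nat) \<Rightarrow>\<^sub>0 'b"
    using that by (simp add: carrier_mpoly_ring)
  have inv: "\<exists>y\<in>carrier (mpoly_ring V). y + x = 0"
    if "x \<in> carrier (mpoly_ring V)" for x :: "('a \<Rightarrow>\<^sub>0 nat) \<Rightarrow>\<^sub>0 'b"
    using minus[OF that] by (intro bexI[of _ "- x"]) auto
  show ?thesis
    by (intro cringI abelian_groupI comm_monoidI)
       (use inv in \<open>auto simp: add mult algebra_simps\<close>,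
        auto simp: carrier_mpoly_ring)
qed


section \<open>Krull dimension\<close>

text \<open>
  The value lives in \<^typ>\<open>ereal\<close> so that the zero ring, which has no prime ideals, gets
  dimension \<open>-\<infinity>\<close>, and a ring with arbitrarily long chains gets \<open>\<infinity>\<close>.
\<close>

definition prime_chain :: "('a, 'b) ring_scheme \<Rightarrow> nat \<Rightarrow> (nat \<Rightarrow> 'a set) \<Rightarrow> bool" where
  "prime_chain R d P \<longleftrightarrow> (\<forall>i\<le>d. primeideal (P i) R) \<and> (\<forall>i<d. P i \<subset> P (Suc i))"

definition krull_dim :: "('a, 'b) ring_scheme \<Rightarrow> ereal" where
  "krull_dim R = (SUP d \<in> {d. \<exists>P. prime_chain R d P}. ereal (real d))"


section \<open>Regular sequences and complete intersections\<close>

definition nonzerodivisor :: "('a, 'b) ring_scheme \<Rightarrow> 'a \<Rightarrow> bool" where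
  "nonzerodivisor R a \<longleftrightarrow> (\<forall>x \<in> carrier R. a \<otimes>\<^bsub>R\<^esub> x = \<zero>\<^bsub>R\<^esub> \<longrightarrow> x = \<zero>\<^bsub>R\<^esub>)"

definition regular_sequence :: "('a, 'b) ring_scheme \<Rightarrow> 'a list \<Rightarrow> bool" where
  "regular_sequence R fs \<longleftrightarrow>
     set fs \<subseteq> carrier R \<and>
     genideal R (set fs) \<noteq> carrier R \<and>
     (\<forall>i < length fs.
        let I = genideal R (set (take i fs))
        in nonzerodivisor (R Quot I) (I +>\<^bsub>R\<^esub> (fs ! i)))"

text \<open>\<open>R Quot J\<close> is a complete intersection; the property is one of the pair \<open>(R, J)\<close>.\<close>

definition complete_intersection :: "('a, 'b) ring_scheme \<Rightarrow> 'a set \<Rightarrow> bool" where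
  "complete_intersection R J \<longleftrightarrow> (\<exists>fs. regular_sequence R fs \<and> J = genideal R (set fs))"


section \<open>The commutator of two generic matrices\<close>

datatype indet = IX nat nat | IY nat nat

text \<open>Matrix indices start at \<open>0\<close>, as in \<^typ>\<open>'a mat\<close>.\<close>

definition indets :: "nat \<Rightarrow> indet set" where
  "indets n = {IX i j | i j. i < n \<and> j < n} \<union> {IY i j | i j. i < n \<and> j < n}"

definition generic_X :: "nat \<Rightarrow> ((indet \<Rightarrow>\<^sub>0 nat) \<Rightarrow>\<^sub>0 'k::field) mat" where
  "generic_X n = mat n n (\<lambda>(i, j). indet_poly (IX i j))"

definition generic_Y :: "nat \<Rightarrow> ((indet \<Rightarrow>\<^sub>0 nat) \<Rightarrow>\<^sub>0 'k::field) mat" where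
  "generic_Y n = mat n n (\<lambda>(i, j). indet_poly (IY i j))"

definition generic_commutator :: "nat \<Rightarrow> ((indet \<Rightarrow>\<^sub>0 nat) \<Rightarrow>\<^sub>0 'k::field) mat" where
  "generic_commutator n = generic_X n * generic_Y n - generic_Y n * generic_X n"

text \<open>With indices from \<open>0\<close>, the anti-diagonal position \<open>(i, n + 1 - i)\<close> becomes \<open>(i, n - 1 - i)\<close>.\<close>

definition antidiag_ideal :: "nat \<Rightarrow> ((indet \<Rightarrow>\<^sub>0 nat) \<Rightarrow>\<^sub>0 'k::field) set" where
  "antidiag_ideal n =
     genideal (mpoly_ring (indets n)) {generic_commutator n $$ (i, n - 1 - i) | i. i < n}"

lemma generic_commutator_in_carrier:
  assumes "i < n" "j < n"
  shows "generic_commutator n $$ (i, j) \<in> carrier (mpoly_ring (indets n))"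
proof -
  interpret cring "mpoly_ring (indets n) :: ((indet \<Rightarrow>\<^sub>0 nat) \<Rightarrow>\<^sub>0 'a) ring"
    by (rule cring_mpoly_ring)
  have sum: "(\<Sum>k\<in>A. f k) \<in> carrier (mpoly_ring (indets n))"
    if "\<And>k. k \<in> A \<Longrightarrow> f k \<in> carrier (mpoly_ring (indets n))" and "finite A"
    for A :: "nat set" and f :: "nat \<Rightarrow> (indet \<Rightarrow>\<^sub>0 nat) \<Rightarrow>\<^sub>0 'a"
    using that(2,1)
  proof (induction A rule: finite_induct)
    case empty
    show ?case using zero_closed by simp
  next
    case (insert k A)
    then show ?case using a_closed[of "f k" "sum f A"] by simp
  qed
  have prod: "indet_poly v * indet_poly w \<in> carrier (mpoly_ring (indets n) :: ((indet \<Rightarrow>\<^sub>0 nat) \<Rightarrow>\<^sub>0 'a) ring)"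
    if "v \<in> indets n" "w \<in> indets n" for v w
    using m_closed[OF indet_poly_in_mpoly_ring[OF that(1)] indet_poly_in_mpoly_ring[OF that(2)]] by simp
  have uminus: "- x \<in> carrier (mpoly_ring (indets n))"
    if "x \<in> carrier (mpoly_ring (indets n))" for x :: "(indet \<Rightarrow>\<^sub>0 nat) \<Rightarrow>\<^sub>0 'a"
    using that by (simp add: carrier_mpoly_ring)
  have "generic_commutator n $$ (i, j) =
    (\<Sum>k\<in>{0..<n}. indet_poly (IX i k) * indet_poly (IY k j)) +
    - (\<Sum>k\<in>{0..<n}. indet_poly (IY i k) * indet_poly (IX k j) :: (indet \<Rightarrow>\<^sub>0 nat) \<Rightarrow>\<^sub>0 'a)"
    using assms by (simp add: generic_commutator_def generic_X_def generic_Y_def scalar_prod_def)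
  moreover have "\<dots> \<in> carrier (mpoly_ring (indets n))"
  proof -
    have "(\<Sum>k\<in>{0..<n}. indet_poly (IX i k) * indet_poly (IY k j) :: (indet \<Rightarrow>\<^sub>0 nat) \<Rightarrow>\<^sub>0 'a)
            \<in> carrier (mpoly_ring (indets n))"
      by (intro sum prod) (use assms in \<open>auto simp: indets_def\<close>)
    moreover have "(\<Sum>k\<in>{0..<n}. indet_poly (IY i k) * indet_poly (IX k j) :: (indet \<Rightarrow>\<^sub>0 nat) \<Rightarrow>\<^sub>0 'a)
            \<in> carrier (mpoly_ring (indets n))"
      by (intro sum prod) (use assms in \<open>auto simp: indets_def\<close>)
    ultimately show ?thesis
      by (rule a_closed[OF _ uminus, unfolded mpoly_ring_simps])
  qed
  ultimately show ?thesis by simp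
qed

end

theory Submission
  imports Defs
begin

text \<open>
Number rows and columns from \<open>0\<close>, write \<open>j' = n - 1 - j\<close>, and let \<open>f j\<close> be the anti-diagonal entry
\<open>\<Sum>k. x j k * y k j' - \<Sum>k. y j k * x k j'\<close>.

\<^bold>\<open>Regularity.\<close> Give weight 1 to the indeterminates in column \<open>0\<close> of \<open>X\<close> and in row \<open>0\<close> of \<open>Y\<close>, and
weight 0 to all others. For \<open>n \<ge> 2\<close> the only monomial of weight 2 in \<open>f j\<close> is \<open>x j 0 * y 0 j'\<close>, and for
different \<open>j\<close> these monomials have no indeterminate in common. Monomials that are pairwise coprime form a
regular sequence, and regularity passes from the top-weight parts to the polynomials themselves
(locale \<open>coprime_leading_monomials\<close>).

\<^bold>\<open>Upper bound.\<close> Take a chain of \<open>d + 1\<close> primes above \<open>J\<close> and choose an element in each step of it. These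
\<open>d\<close> elements, together with the \<open>n\<close> elements \<open>f j\<close>, are algebraically independent over the field: in
a hypothetical relation one divides by the elements one after the other, each being a nonzerodivisor modulo
the ideal reached so far and a member of the next ideal, until a nonzero constant lies in a proper ideal
(\<open>tower_monomials_independent\<close>). A count of monomials shows that a polynomial ring in \<open>2 * n\<^sup>2\<close>
indeterminates does not contain more than \<open>2 * n\<^sup>2\<close> algebraically independent elements
(\<open>tower_length_le_card\<close>), so \<open>d + n \<le> 2 * n\<^sup>2\<close>.

\<^bold>\<open>Lower bound.\<close> For fixed \<open>Y\<close> the equations \<open>f j = 0\<close> are linear in \<open>X\<close>, and they form a triangular system for
column \<open>0\<close> of \<open>X\<close>. Solving it and clearing denominators yields a polynomial map from affine space of
dimension \<open>2 * n\<^sup>2 - n\<close> into the zero set of \<open>J\<close> (\<open>parametrization\<close>). Setting the parameters to zero one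
after the other, those of \<open>X\<close> before those of \<open>Y\<close>, gives a strictly increasing chain of kernels, all prime
and all containing \<open>J\<close> (\<open>prime_chain_of_parametrization\<close>, \<open>parametrization_generic\<close>).
\<close>

section \<open>Polynomials and their ideals\<close>

lemma poly_eq_sum_terms:
  fixes p :: "'a \<Rightarrow>\<^sub>0 'b::comm_monoid_add"
  shows "p = (\<Sum>m\<in>Poly_Mapping.keys p. Poly_Mapping.single m (Poly_Mapping.lookup p m))"
proof (rule poly_mapping_eqI)
  fix k
  show "Poly_Mapping.lookup p k = Poly_Mapping.lookup
     (\<Sum>m\<in>Poly_Mapping.keys p. Poly_Mapping.single m (Poly_Mapping.lookup p m)) k"
    by (cases "k \<in> Poly_Mapping.keys p")
       (auto simp: lookup_sum lookup_single when_def in_keys_iff)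
qed

lemma lookup_single_times:
  fixes p :: "('v \<Rightarrow>\<^sub>0 nat) \<Rightarrow>\<^sub>0 'k::comm_ring_1"
  shows "Poly_Mapping.lookup (Poly_Mapping.single a c * p) (a + m) = c * Poly_Mapping.lookup p m"
proof -
  have "Poly_Mapping.lookup (Poly_Mapping.single a c * p) (a + m)
    = (\<Sum>k\<in>Poly_Mapping.keys p. Poly_Mapping.lookup (Poly_Mapping.single a c *
         Poly_Mapping.single k (Poly_Mapping.lookup p k)) (a + m))"
    by (subst poly_eq_sum_terms[of p]) (simp only: sum_distrib_left lookup_sum)
  also have "\<dots> = (\<Sum>k\<in>Poly_Mapping.keys p. if k = m then c * Poly_Mapping.lookup p m else 0)"
    by (intro sum.cong) (auto simp: mult_single lookup_single when_def)
  also have "\<dots> = c * Poly_Mapping.lookup p m"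
    by (auto simp: in_keys_iff)
  finally show ?thesis .
qed

lemma single_in_mpoly_ring:
  "Poly_Mapping.keys m \<subseteq> V \<Longrightarrow> Poly_Mapping.single m c \<in> carrier (mpoly_ring V)"
  by (auto simp: carrier_mpoly_ring split: if_splits)

lemma mpoly_ring_closed:
  fixes p q :: "('v \<Rightarrow>\<^sub>0 nat) \<Rightarrow>\<^sub>0 'k::field"
  assumes "p \<in> carrier (mpoly_ring V)" "q \<in> carrier (mpoly_ring V)"
  shows "p + q \<in> carrier (mpoly_ring V)" "p * q \<in> carrier (mpoly_ring V)"
    "- p \<in> carrier (mpoly_ring V)" "p - q \<in> carrier (mpoly_ring V)"
proof -
  interpret cring "mpoly_ring V :: (('v \<Rightarrow>\<^sub>0 nat) \<Rightarrow>\<^sub>0 'k) ring" by (rule cring_mpoly_ring)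
  show "p + q \<in> carrier (mpoly_ring V)" "p * q \<in> carrier (mpoly_ring V)"
    using a_closed[OF assms] m_closed[OF assms] by simp_all
  have neg: "- r \<in> carrier (mpoly_ring V)" if "r \<in> carrier (mpoly_ring V)"
    for r :: "('v \<Rightarrow>\<^sub>0 nat) \<Rightarrow>\<^sub>0 'k"
    using that by (simp add: carrier_mpoly_ring)
  show "- p \<in> carrier (mpoly_ring V)" by (rule neg[OF assms(1)])
  show "p - q \<in> carrier (mpoly_ring V)"
    using a_closed[OF assms(1) neg[OF assms(2)]] by simp
qed

lemma zero_one_in_mpoly_ring [simp]:
  "0 \<in> carrier (mpoly_ring V)" "1 \<in> carrier (mpoly_ring V)"
  by (auto simp: carrier_mpoly_ring)

lemma sum_in_mpoly_ring:
  assumes "\<And>i. i \<in> A \<Longrightarrow> f i \<in> carrier (mpoly_ring V)"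
  shows "(\<Sum>i\<in>A. f i) \<in> carrier (mpoly_ring V)"
  using assms by (induction A rule: infinite_finite_induct) (auto intro: mpoly_ring_closed)

lemma prod_in_mpoly_ring:
  assumes "\<And>i. i \<in> A \<Longrightarrow> f i \<in> carrier (mpoly_ring V)"
  shows "(\<Prod>i\<in>A. f i) \<in> carrier (mpoly_ring V)"
  using assms by (induction A rule: infinite_finite_induct) (auto intro: mpoly_ring_closed)

lemma power_in_mpoly_ring:
  assumes "p \<in> carrier (mpoly_ring V)"
  shows "p ^ k \<in> carrier (mpoly_ring V)"
  using assms by (induction k) (auto intro: mpoly_ring_closed)

lemma ideal_mpoly_ring_closed:
  fixes p q :: "('v \<Rightarrow>\<^sub>0 nat) \<Rightarrow>\<^sub>0 'k::field"
  assumes "ideal I (mpoly_ring V)"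
  shows "0 \<in> I" "p \<in> I \<Longrightarrow> p \<in> carrier (mpoly_ring V)"
    "p \<in> I \<Longrightarrow> q \<in> I \<Longrightarrow> p + q \<in> I" "p \<in> I \<Longrightarrow> - p \<in> I" "p \<in> I \<Longrightarrow> q \<in> I \<Longrightarrow> p - q \<in> I"
    "p \<in> I \<Longrightarrow> q \<in> carrier (mpoly_ring V) \<Longrightarrow> p * q \<in> I"
    "p \<in> I \<Longrightarrow> q \<in> carrier (mpoly_ring V) \<Longrightarrow> q * p \<in> I"
proof -
  interpret ideal I "mpoly_ring V :: (('v \<Rightarrow>\<^sub>0 nat) \<Rightarrow>\<^sub>0 'k) ring" by fact
  show "0 \<in> I" using additive_subgroup.zero_closed[OF additive_subgroup_axioms] by simp
  show "p \<in> I \<Longrightarrow> p \<in> carrier (mpoly_ring V)" by (rule Icarr)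
  show add: "p \<in> I \<Longrightarrow> q \<in> I \<Longrightarrow> p + q \<in> I" for p q
    using additive_subgroup.a_closed[OF additive_subgroup_axioms, of p q] by simp
  show r: "p \<in> I \<Longrightarrow> q \<in> carrier (mpoly_ring V) \<Longrightarrow> p * q \<in> I" for p q
    using I_r_closed[of p q] by simp
  then show "p \<in> I \<Longrightarrow> q \<in> carrier (mpoly_ring V) \<Longrightarrow> q * p \<in> I"
    by (simp add: mult.commute)
  show neg: "p \<in> I \<Longrightarrow> - p \<in> I" for p
    using r[of p "- 1"] mpoly_ring_closed(3)[OF zero_one_in_mpoly_ring(2,2), of V] by simp
  show "p \<in> I \<Longrightarrow> q \<in> I \<Longrightarrow> p - q \<in> I" using add[of p "- q"] neg[of q] by simp
qed

lemma ideal_mpoly_ring_sum: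
  fixes f :: "'a \<Rightarrow> ('v \<Rightarrow>\<^sub>0 nat) \<Rightarrow>\<^sub>0 'k::field"
  assumes "ideal I (mpoly_ring V)" "\<And>i. i \<in> A \<Longrightarrow> f i \<in> I"
  shows "(\<Sum>i\<in>A. f i) \<in> I"
  using assms(2) by (induction A rule: infinite_finite_induct)
    (auto intro: ideal_mpoly_ring_closed(1,3)[OF assms(1)])

lemma genideal_insert_mpoly_ring:
  fixes a :: "('v \<Rightarrow>\<^sub>0 nat) \<Rightarrow>\<^sub>0 'k::field" and V :: "'v set"
  defines "R \<equiv> mpoly_ring V :: (('v \<Rightarrow>\<^sub>0 nat) \<Rightarrow>\<^sub>0 'k) ring"
  assumes "A \<subseteq> carrier R" "a \<in> carrier R" "h \<in> genideal R (insert a A)"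
  obtains h' g where "h' \<in> genideal R A" "g \<in> carrier R" "h = h' + g * a"
proof -
  interpret cring R unfolding R_def by (rule cring_mpoly_ring)
  have IA: "ideal (genideal R A) R" and Ia: "ideal (PIdl\<^bsub>R\<^esub> a) R"
    using assms genideal_ideal cgenideal_ideal by auto
  have "insert a A \<subseteq> genideal R A \<union> PIdl\<^bsub>R\<^esub> a"
    using genideal_self[OF assms(2)] cgenideal_self[OF assms(3)] by auto
  also have "\<dots> \<subseteq> genideal R A <+>\<^bsub>R\<^esub> PIdl\<^bsub>R\<^esub> a"
    using union_genideal[OF IA Ia] genideal_self[of "genideal R A \<union> PIdl\<^bsub>R\<^esub> a"]
      ideal.Icarr[OF IA] ideal.Icarr[OF Ia] by (simp add: subset_iff)
  finally have "genideal R (insert a A) \<subseteq> genideal R A <+>\<^bsub>R\<^esub> PIdl\<^bsub>R\<^esub> a"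
    by (rule genideal_minimal[OF add_ideals[OF IA Ia]])
  then have "h \<in> genideal R A <+>\<^bsub>R\<^esub> PIdl\<^bsub>R\<^esub> a" using assms(4) by blast
  then obtain x y where "x \<in> genideal R A" "y \<in> PIdl\<^bsub>R\<^esub> a" "h = x + y"
    unfolding set_add_def' by (auto simp: R_def)
  then show thesis using that unfolding cgenideal_def by (auto simp: R_def)
qed

section \<open>Regular sequences from coprime leading monomials\<close>

lemma nonzerodivisor_Quot_iff:
  assumes "cring R" "ideal I R" "a \<in> carrier R"
  shows "nonzerodivisor (R Quot I) (I +>\<^bsub>R\<^esub> a) \<longleftrightarrow>
    (\<forall>x\<in>carrier R. a \<otimes>\<^bsub>R\<^esub> x \<in> I \<longrightarrow> x \<in> I)"
proof -
  interpret cring R by fact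
  interpret ideal I R by fact
  have carr: "carrier (R Quot I) = (\<lambda>x. I +>\<^bsub>R\<^esub> x) ` carrier R"
    unfolding FactRing_def A_RCOSETS_def' by auto
  have zero: "I +>\<^bsub>R\<^esub> x = I \<longleftrightarrow> x \<in> I" if "x \<in> carrier R" for x
    using a_rcos_zero[OF assms(2)] a_rcos_self[OF that] by auto
  have "(I +>\<^bsub>R\<^esub> a) \<otimes>\<^bsub>R Quot I\<^esub> (I +>\<^bsub>R\<^esub> x) = I +>\<^bsub>R\<^esub> (a \<otimes>\<^bsub>R\<^esub> x)" if "x \<in> carrier R" for x
    using rcoset_mult_add[OF assms(3) that] by (simp add: FactRing_def)
  then show ?thesis
    unfolding nonzerodivisor_def carr
    by (auto simp: zero assms(3) FactRing_def)
qed

text \<open>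
Here \<open>e i\<close> is the unique monomial of largest weight in \<open>f i\<close>. An additive weight with values in \<open>nat\<close> takes the
place of a monomial order: other polynomials may have several monomials of top weight, but every argument
about leading parts becomes an induction on a natural number.
\<close>

locale coprime_leading_monomials =
  fixes V :: "'v set"
    and f :: "nat \<Rightarrow> ('v \<Rightarrow>\<^sub>0 nat) \<Rightarrow>\<^sub>0 'k::field"
    and e :: "nat \<Rightarrow> 'v \<Rightarrow>\<^sub>0 nat"
    and wt :: "('v \<Rightarrow>\<^sub>0 nat) \<Rightarrow> nat"
    and N :: nat
  assumes wt_add: "wt (a + b) = wt a + wt b"
    and f_carrier: "i < N \<Longrightarrow> f i \<in> carrier (mpoly_ring V)"
    and lookup_lead: "i < N \<Longrightarrow> Poly_Mapping.lookup (f i) (e i) = 1"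
    and wt_tail: "i < N \<Longrightarrow> m \<in> Poly_Mapping.keys (f i) \<Longrightarrow> m \<noteq> e i \<Longrightarrow> wt m < wt (e i)"
    and lead_nonzero: "i < N \<Longrightarrow> e i \<noteq> 0"
    and coprime: "i < N \<Longrightarrow> j < N \<Longrightarrow> i \<noteq> j \<Longrightarrow> Poly_Mapping.keys (e i) \<inter> Poly_Mapping.keys (e j) = {}"
begin

abbreviation R :: "(('v \<Rightarrow>\<^sub>0 nat) \<Rightarrow>\<^sub>0 'k) ring" where "R \<equiv> mpoly_ring V"

definition partial_ideal :: "nat \<Rightarrow> (('v \<Rightarrow>\<^sub>0 nat) \<Rightarrow>\<^sub>0 'k) set" where
  "partial_ideal i = genideal R (f ` {..<i})"

text \<open>
Membership of a monomial in the monomial ideal generated by \<open>e 0, \<dots>, e (i - 1)\<close>.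
\<close>

definition lead_divides :: "nat \<Rightarrow> ('v \<Rightarrow>\<^sub>0 nat) \<Rightarrow> bool" where
  "lead_divides i m \<longleftrightarrow> (\<exists>j<i. \<forall>v. Poly_Mapping.lookup (e j) v \<le> Poly_Mapping.lookup m v)"

lemma generators_in_carrier: "i \<le> N \<Longrightarrow> f ` {..<i} \<subseteq> carrier R"
  using f_carrier by auto

lemma ideal_partial_ideal: "i \<le> N \<Longrightarrow> ideal (partial_ideal i) R"
  unfolding partial_ideal_def
  by (rule ring.genideal_ideal[OF cring.axioms(1)[OF cring_mpoly_ring] generators_in_carrier])

lemma generator_in_partial_ideal: "j < i \<Longrightarrow> i \<le> N \<Longrightarrow> f j \<in> partial_ideal i"
  unfolding partial_ideal_def
  using ring.genideal_self[OF cring.axioms(1)[OF cring_mpoly_ring] generators_in_carrier[of i]]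
  by auto

lemma partial_ideal_0: "partial_ideal 0 = {0}"
proof -
  interpret cring R by (rule cring_mpoly_ring)
  have "genideal R {} \<subseteq> {\<zero>\<^bsub>R\<^esub>}" by (rule genideal_minimal[OF zeroideal]) simp
  moreover have "0 \<in> partial_ideal 0"
    using ideal_mpoly_ring_closed(1)[OF ideal_partial_ideal[of 0]] by simp
  ultimately show ?thesis by (auto simp: partial_ideal_def)
qed

lemma partial_ideal_Suc:
  assumes "i < N" "h \<in> partial_ideal (Suc i)"
  obtains h' g where "h' \<in> partial_ideal i" "g \<in> carrier R" "h = h' + g * f i"
proof -
  have "f ` {..<Suc i} = insert (f i) (f ` {..<i})" by (auto simp: less_Suc_eq)
  with assms(2) have "h \<in> genideal R (insert (f i) (f ` {..<i}))" by (simp add: partial_ideal_def)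
  then obtain h' g where "h' \<in> genideal R (f ` {..<i})" "g \<in> carrier R" "h = h' + g * f i"
    using genideal_insert_mpoly_ring[OF generators_in_carrier f_carrier[OF assms(1)], of i] assms(1)
    by auto
  then show thesis using that by (simp add: partial_ideal_def)
qed

lemma lead_divides_decompose:
  assumes "lead_divides i m"
  obtains j a where "j < i" "m = a + e j" "Poly_Mapping.keys a \<subseteq> Poly_Mapping.keys m"
proof -
  obtain j where j: "j < i" "\<And>v. Poly_Mapping.lookup (e j) v \<le> Poly_Mapping.lookup m v"
    using assms by (auto simp: lead_divides_def)
  have "m = (m - e j) + e j"
    by (rule poly_mapping_eqI) (use j(2) in \<open>simp add: lookup_add lookup_minus\<close>)
  moreover have "Poly_Mapping.keys (m - e j) \<subseteq> Poly_Mapping.keys m"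
    by (auto simp: in_keys_iff lookup_minus)
  ultimately show thesis using that j(1) by blast
qed

text \<open>
This is where coprimality enters: the monomials \<open>e 0, e 1, \<dots>\<close> form a regular sequence.
\<close>

lemma lead_divides_cancel:
  assumes "i < N" "lead_divides i (a + e i)"
  shows "lead_divides i a"
proof -
  obtain j where j: "j < i"
    "\<And>v. Poly_Mapping.lookup (e j) v \<le> Poly_Mapping.lookup a v + Poly_Mapping.lookup (e i) v"
    using assms(2) by (auto simp: lead_divides_def lookup_add)
  have "Poly_Mapping.lookup (e j) v \<le> Poly_Mapping.lookup a v" for v
  proof (cases "v \<in> Poly_Mapping.keys (e j)")
    case True
    then have "Poly_Mapping.lookup (e i) v = 0"
      using coprime[of i j] assms(1) j(1) by (auto simp: in_keys_iff)
    with j(2)[of v] show ?thesis by simp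
  qed (simp add: in_keys_iff)
  with j(1) show ?thesis by (auto simp: lead_divides_def)
qed

text \<open>
If all weights in \<open>g\<close> are at most \<open>d\<close>, the part of weight \<open>d + wt (e i)\<close> in \<open>g * f i\<close> is the part of weight \<open>d\<close> in \<open>g\<close>, shifted by \<open>e i\<close>. This lemma
gives one inclusion between the two sets of monomials, \<open>top_key_times_generator\<close> the other.
\<close>

lemma keys_times_generator:
  assumes "i < N" "\<And>a. a \<in> Poly_Mapping.keys g \<Longrightarrow> wt a \<le> d" "m \<in> Poly_Mapping.keys (g * f i)"
  shows "wt m < d + wt (e i) \<or> (\<exists>a\<in>Poly_Mapping.keys g. m = a + e i \<and> wt m \<le> d + wt (e i))"
proof -
  obtain a b where ab: "a \<in> Poly_Mapping.keys g" "b \<in> Poly_Mapping.keys (f i)" "m = a + b"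
    using keys_mult[of g "f i"] assms(3) by blast
  show ?thesis
  proof (cases "b = e i")
    case True
    with ab assms(2)[OF ab(1)] show ?thesis by (auto simp: wt_add)
  next
    case False
    with ab assms(2)[OF ab(1)] wt_tail[OF assms(1) ab(2)] show ?thesis by (auto simp: wt_add)
  qed
qed

lemma keys_tail: "i < N \<Longrightarrow> m \<in> Poly_Mapping.keys (f i - Poly_Mapping.single (e i) 1) \<Longrightarrow> wt m < wt (e i)"
  using wt_tail[of i m] lookup_lead[of i]
  by (cases "m = e i") (auto simp: in_keys_iff lookup_minus lookup_single when_def)

lemma top_key_times_generator:
  assumes "i < N" "\<And>a. a \<in> Poly_Mapping.keys g \<Longrightarrow> wt a \<le> d" "a \<in> Poly_Mapping.keys g" "wt a = d"
  shows "a + e i \<in> Poly_Mapping.keys (g * f i)"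
proof -
  define l where "l = f i - Poly_Mapping.single (e i) 1"
  have "g * f i = Poly_Mapping.single (e i) 1 * g + g * l"
    by (simp add: l_def algebra_simps)
  moreover have "a + e i \<notin> Poly_Mapping.keys (g * l)"
  proof
    assume "a + e i \<in> Poly_Mapping.keys (g * l)"
    then obtain b c where "b \<in> Poly_Mapping.keys g" "c \<in> Poly_Mapping.keys l" "a + e i = b + c"
      using keys_mult[of g l] by blast
    moreover from this(3) have "wt a + wt (e i) = wt b + wt c" by (metis wt_add)
    ultimately show False
      using assms(2)[of b] keys_tail[OF assms(1), of c] assms(4) by (simp add: l_def)
  qed
  moreover have "Poly_Mapping.lookup (Poly_Mapping.single (e i) 1 * g) (a + e i) \<noteq> 0"
    using lookup_single_times[of "e i" 1 g a] assms(3) by (simp add: add.commute in_keys_iff)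
  ultimately show ?thesis by (simp add: in_keys_iff lookup_add)
qed

text \<open>
Division with remainder, in the top weight only: in each top term \<open>e j\<close> may be replaced by \<open>e j - f j\<close>, which has
smaller weight.
\<close>

lemma reduce_top:
  assumes "i \<le> N" "g \<in> carrier R" "\<And>m. m \<in> Poly_Mapping.keys g \<Longrightarrow> wt m \<le> d"
    "\<And>m. m \<in> Poly_Mapping.keys g \<Longrightarrow> wt m = d \<Longrightarrow> lead_divides i m"
  obtains r where "r \<in> partial_ideal i" "\<And>m. m \<in> Poly_Mapping.keys (g - r) \<Longrightarrow> wt m < d"
proof -
  note I = ideal_mpoly_ring_closed[OF ideal_partial_ideal[OF assms(1)]]
  have "\<exists>r\<in>partial_ideal i. \<forall>m'\<in>Poly_Mapping.keys (Poly_Mapping.single m (Poly_Mapping.lookup g m) - r). wt m' < d"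
    if m: "m \<in> Poly_Mapping.keys g" for m
  proof (cases "wt m = d")
    case False
    then show ?thesis using assms(3)[OF m] I(1)
      by (intro bexI[of _ 0]) (auto split: if_splits)
  next
    case True
    obtain j a where ja: "j < i" "m = a + e j" "Poly_Mapping.keys a \<subseteq> Poly_Mapping.keys m"
      using lead_divides_decompose[OF assms(4)[OF m True]] .
    let ?a = "Poly_Mapping.single a (Poly_Mapping.lookup g m)"
    have "?a \<in> carrier R"
      using ja(3) m assms(2) by (intro single_in_mpoly_ring) (auto simp: carrier_mpoly_ring)
    then have "?a * f j \<in> partial_ideal i"
      using I(7) generator_in_partial_ideal[OF ja(1) assms(1)] by blast
    moreover have "wt m' < d"
      if "m' \<in> Poly_Mapping.keys (Poly_Mapping.single m (Poly_Mapping.lookup g m) - ?a * f j)" for m'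
    proof -
      have "Poly_Mapping.single m (Poly_Mapping.lookup g m) - ?a * f j
          = - (?a * (f j - Poly_Mapping.single (e j) 1))"
        by (simp add: algebra_simps mult_single ja(2))
      then have "m' \<in> Poly_Mapping.keys (?a * (f j - Poly_Mapping.single (e j) 1))"
        using that by (simp only: keys_minus)
      then obtain a' b where "a' \<in> Poly_Mapping.keys ?a"
        "b \<in> Poly_Mapping.keys (f j - Poly_Mapping.single (e j) 1)" "m' = a' + b"
        using keys_mult by blast
      then have "b \<in> Poly_Mapping.keys (f j - Poly_Mapping.single (e j) 1)" "m' = a + b"
        by (auto split: if_splits)
      then show ?thesis
        using keys_tail[of j b] ja assms(1) True by (simp add: wt_add)
    qed
    ultimately show ?thesis by blast
  qed
  then obtain r where r: "\<And>m. m \<in> Poly_Mapping.keys g \<Longrightarrow> r m \<in> partial_ideal i"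
    "\<And>m m'. m \<in> Poly_Mapping.keys g \<Longrightarrow>
      m' \<in> Poly_Mapping.keys (Poly_Mapping.single m (Poly_Mapping.lookup g m) - r m) \<Longrightarrow> wt m' < d"
    by metis
  show thesis
  proof (rule that[of "\<Sum>m\<in>Poly_Mapping.keys g. r m"])
    show "(\<Sum>m\<in>Poly_Mapping.keys g. r m) \<in> partial_ideal i"
      using r(1) by (intro ideal_mpoly_ring_sum[OF ideal_partial_ideal[OF assms(1)]])
    fix m' assume "m' \<in> Poly_Mapping.keys (g - (\<Sum>m\<in>Poly_Mapping.keys g. r m))"
    moreover have "g - (\<Sum>m\<in>Poly_Mapping.keys g. r m)
      = (\<Sum>m\<in>Poly_Mapping.keys g. Poly_Mapping.single m (Poly_Mapping.lookup g m) - r m)"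
      by (subst (1) poly_eq_sum_terms[of g]) (simp add: sum_subtractf)
    ultimately have "m' \<in> (\<Union>m\<in>Poly_Mapping.keys g. Poly_Mapping.keys (Poly_Mapping.single m (Poly_Mapping.lookup g m) - r m))"
      using keys_sum[of "\<lambda>m. Poly_Mapping.single m (Poly_Mapping.lookup g m) - r m" "Poly_Mapping.keys g"]
      by auto
    then show "wt m' < d" using r(2) by blast
  qed
qed

text \<open>
The top-weight part of an element of \<open>(f 0, \<dots>, f (i - 1))\<close> lies in the ideal of the leading monomials. For the
step from \<open>i\<close> to \<open>i + 1\<close> write the element as \<open>h' + g * f i\<close>. Trouble arises only if the top parts of the
two summands cancel. In that case the top part of \<open>g * e i\<close> lies in the monomial ideal of \<open>e 0, \<dots>, e (i - 1)\<close>, hence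
so does that of \<open>g\<close>, and \<open>reduce_top\<close> moves it into \<open>h'\<close>, which lowers the weight of \<open>g\<close>.
\<close>

lemma top_of_partial_ideal:
  assumes "i \<le> N" "h \<in> partial_ideal i" "\<And>m. m \<in> Poly_Mapping.keys h \<Longrightarrow> wt m \<le> D"
    "m \<in> Poly_Mapping.keys h" "wt m = D"
  shows "lead_divides i m"
  using assms
proof (induction i arbitrary: h D m)
  case 0
  then show ?case by (simp add: partial_ideal_0)
next
  case (Suc i)
  have iN: "i < N" using Suc.prems(1) by simp
  have i_le: "i \<le> N" using iN by simp
  note I = ideal_mpoly_ring_closed[OF ideal_partial_ideal[OF i_le]]
  note IH = Suc.IH[OF i_le] and h = Suc.prems(3-5)
  have mono: "lead_divides i a \<Longrightarrow> lead_divides (Suc i) a" for a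
    by (auto simp: lead_divides_def less_Suc_eq)
  have lead: "lead_divides (Suc i) (a + e i)" for a
    by (auto simp: lead_divides_def lookup_add)
  have "lead_divides (Suc i) m"
    if "h' \<in> partial_ideal i" "g \<in> carrier R" "\<And>a. a \<in> Poly_Mapping.keys g \<Longrightarrow> wt a < d" "h = h' + g * f i"
    for d h' g
    using that
  proof (induction d arbitrary: h' g)
    case 0
    then have "Poly_Mapping.keys g = {}" by blast
    then have "h = h'" using 0 by simp
    then show ?case using IH[OF 0(1)] h mono by blast
  next
    case (Suc d)
    have g: "wt a \<le> d" if "a \<in> Poly_Mapping.keys g" for a
      using Suc.prems(3)[OF that] by simp
    have h': "h' = h - g * f i" using Suc.prems(4) by simp
    have gf: "wt a < d + wt (e i) \<or> (\<exists>b\<in>Poly_Mapping.keys g. a = b + e i \<and> wt a \<le> d + wt (e i))"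
      if "a \<in> Poly_Mapping.keys (g * f i)" for a
      using keys_times_generator[OF iN g that] .
    show ?case
    \<comment> \<open>In the second case \<open>h\<close> has smaller weight than \<open>g * f i\<close> may have, so the top parts of \<open>h'\<close> and \<open>g * f i\<close> cancel.\<close>
    proof (cases "d + wt (e i) \<le> D")
      case True
      have h'_le: "wt m' \<le> D" if "m' \<in> Poly_Mapping.keys h'" for m'
      proof -
        have "m' \<in> Poly_Mapping.keys h \<or> m' \<in> Poly_Mapping.keys (g * f i)"
          using that by (auto simp: h' in_keys_iff lookup_minus)
        then show ?thesis using h(1)[of m'] gf[of m'] True by fastforce
      qed
      have "m \<in> Poly_Mapping.keys h' \<or> m \<in> Poly_Mapping.keys (g * f i)"
        using h(2) by (auto simp: Suc.prems(4) in_keys_iff lookup_add)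
      then show ?thesis
      proof
        assume "m \<in> Poly_Mapping.keys h'"
        then have "lead_divides i m"
          using IH[OF Suc.prems(1) h'_le] h(3) by blast
        then show ?thesis by (rule mono)
      next
        assume "m \<in> Poly_Mapping.keys (g * f i)"
        then show ?thesis using gf[of m] h(3) True lead by auto
      qed
    next
      case False
      have h_low: "wt m' < d + wt (e i)" if "m' \<in> Poly_Mapping.keys h" for m'
        using h(1)[OF that] False by simp
      have h'_le: "wt m' \<le> d + wt (e i)" if "m' \<in> Poly_Mapping.keys h'" for m'
      proof -
        have "m' \<in> Poly_Mapping.keys h \<or> m' \<in> Poly_Mapping.keys (g * f i)"
          using that by (auto simp: h' in_keys_iff lookup_minus)
        then show ?thesis using h_low[of m'] gf[of m'] by fastforce
      qed
      have top: "lead_divides i a" if a: "a \<in> Poly_Mapping.keys g" "wt a = d" for a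
      proof -
        have "a + e i \<in> Poly_Mapping.keys (g * f i)"
          using top_key_times_generator[OF iN g a] .
        moreover have "a + e i \<notin> Poly_Mapping.keys h" using h_low[of "a + e i"] a by (auto simp: wt_add)
        ultimately have "a + e i \<in> Poly_Mapping.keys h'"
          by (simp add: h' in_keys_iff lookup_minus)
        then have "lead_divides i (a + e i)"
          using IH[OF Suc.prems(1) h'_le]
            a by (simp add: wt_add)
        then show ?thesis by (rule lead_divides_cancel[OF iN])
      qed
      obtain r where r: "r \<in> partial_ideal i" "\<And>m. m \<in> Poly_Mapping.keys (g - r) \<Longrightarrow> wt m < d"
        using reduce_top[OF i_le Suc.prems(2) g top] by metis
      show ?thesis
      proof (rule Suc.IH[of "h' + r * f i" "g - r"])
        show "h' + r * f i \<in> partial_ideal i"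
          using I(3,6) Suc.prems(1) r(1) f_carrier[OF iN] by blast
        show "g - r \<in> carrier R" using mpoly_ring_closed(4) Suc.prems(2) I(2) r(1) by blast
        show "h = h' + r * f i + (g - r) * f i" by (simp add: Suc.prems(4) algebra_simps)
      qed (use r(2) in blast)
    qed
  qed
  moreover obtain h' g where "h' \<in> partial_ideal i" "g \<in> carrier R" "h = h' + g * f i"
    using partial_ideal_Suc[OF iN Suc.prems(2)] .
  moreover obtain d where "\<And>a. a \<in> Poly_Mapping.keys g \<Longrightarrow> wt a < d"
    using finite_nat_set_iff_bounded[of "wt ` Poly_Mapping.keys g"] by auto
  ultimately show ?case by blast
qed

text \<open>
If \<open>f i * g\<close> is in the ideal, its top part is in the monomial ideal, so by coprimality the top part of \<open>g\<close>
is as well. Subtracting an element of the ideal lowers the weight of \<open>g\<close>.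
\<close>

lemma nonzerodivisor_mod_partial_ideal:
  assumes "i < N" "g \<in> carrier R" "f i * g \<in> partial_ideal i"
  shows "g \<in> partial_ideal i"
proof -
  have i_le: "i \<le> N" using assms(1) by simp
  note I = ideal_mpoly_ring_closed[OF ideal_partial_ideal[OF i_le]]
  have main: "g \<in> partial_ideal i"
    if "g \<in> carrier R" "g * f i \<in> partial_ideal i" "\<And>a. a \<in> Poly_Mapping.keys g \<Longrightarrow> wt a < d" for d g
    using that
  proof (induction d arbitrary: g)
    case 0
    then have "Poly_Mapping.keys g = {}" by blast
    then show ?case using I(1) by simp
  next
    case (Suc d)
    have g: "wt a \<le> d" if "a \<in> Poly_Mapping.keys g" for a
      using Suc.prems(3)[OF that] by simp
    have gf: "wt m \<le> d + wt (e i)" if "m \<in> Poly_Mapping.keys (g * f i)" for m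
      using keys_times_generator[OF assms(1) g that] by auto
    have top: "lead_divides i a" if a: "a \<in> Poly_Mapping.keys g" "wt a = d" for a
    proof (rule lead_divides_cancel[OF assms(1)])
      show "lead_divides i (a + e i)"
        by (rule top_of_partial_ideal[OF i_le Suc.prems(2) gf top_key_times_generator[OF assms(1) g a]])
           (use a in \<open>auto simp: wt_add\<close>)
    qed
    obtain r where r: "r \<in> partial_ideal i" "\<And>m. m \<in> Poly_Mapping.keys (g - r) \<Longrightarrow> wt m < d"
      using reduce_top[OF i_le Suc.prems(1) g top] by metis
    have "g - r \<in> partial_ideal i"
    proof (rule Suc.IH)
      show "g - r \<in> carrier R" using mpoly_ring_closed(4) Suc.prems(1) I(2) r(1) by blast
      have "g * f i - r * f i \<in> partial_ideal i"
        using I(5,6) Suc.prems(2) r(1) f_carrier[OF assms(1)] by blast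
      then show "(g - r) * f i \<in> partial_ideal i" by (simp add: algebra_simps)
    qed (use r(2) in blast)
    from I(3)[OF this r(1)] show ?case by simp
  qed
  obtain d where "\<And>a. a \<in> Poly_Mapping.keys g \<Longrightarrow> wt a < d"
    using finite_nat_set_iff_bounded[of "wt ` Poly_Mapping.keys g"] by auto
  then show ?thesis using main[of g d] assms(2,3) by (simp add: mult.commute)
qed

lemma partial_ideal_proper:
  assumes "i \<le> N"
  shows "partial_ideal i \<noteq> carrier R"
proof
  assume "partial_ideal i = carrier R"
  then have "1 \<in> partial_ideal i" by simp
  then have "lead_divides i 0"
    by (rule top_of_partial_ideal[OF assms, where D = "wt 0"]) auto
  then obtain j where "j < i" "\<And>v. Poly_Mapping.lookup (e j) v = 0"
    by (auto simp: lead_divides_def)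
  then show False using lead_nonzero[of j] assms by (auto intro: poly_mapping_eqI)
qed

theorem regular_sequence_leads: "regular_sequence R (map f [0..<N])"
proof -
  have set_take: "set (take i (map f [0..<N])) = f ` {..<i}" if "i \<le> N" for i
    using that by (auto simp: take_map)
  have N: "set (map f [0..<N]) = f ` {..<N}" by auto
  show ?thesis
    unfolding regular_sequence_def N
  proof (intro conjI allI impI)
    show "f ` {..<N} \<subseteq> carrier R" using generators_in_carrier by simp
    show "genideal R (f ` {..<N}) \<noteq> carrier R"
      using partial_ideal_proper[of N] by (simp add: partial_ideal_def)
    fix i assume "i < length (map f [0..<N])"
    then have i: "i < N" by simp
    show "let I = genideal R (set (take i (map f [0..<N])))
        in nonzerodivisor (R Quot I) (I +>\<^bsub>R\<^esub> map f [0..<N] ! i)"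
      using nonzerodivisor_mod_partial_ideal[OF i] i set_take[of i]
        nonzerodivisor_Quot_iff[OF cring_mpoly_ring ideal_partial_ideal[of i] f_carrier[OF i]]
      by (simp add: Let_def partial_ideal_def)
  qed
qed

end

section \<open>The length of a tower of ideals\<close>

lemma const_in_mpoly_ring: "Poly_Mapping.single 0 c \<in> carrier (mpoly_ring V)"
  by (rule single_in_mpoly_ring) simp

lemma ideal_mpoly_ring_no_const:
  fixes I :: "(('v \<Rightarrow>\<^sub>0 nat) \<Rightarrow>\<^sub>0 'k::field) set"
  assumes "ideal I (mpoly_ring V)" "I \<noteq> carrier (mpoly_ring V)" "Poly_Mapping.single 0 c \<in> I"
  shows "c = 0"
proof (rule ccontr)
  assume c: "c \<noteq> 0"
  note I = ideal_mpoly_ring_closed[OF assms(1)]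
  have "Poly_Mapping.single 0 (inverse c) * Poly_Mapping.single 0 c \<in> I"
    using I(7) assms(3) const_in_mpoly_ring by blast
  then have "1 \<in> I" using c by (simp add: mult_single)
  then have "p \<in> I" if "p \<in> carrier (mpoly_ring V)" for p using I(6)[of 1 p] that by simp
  then show False using assms(2) I(2) by blast
qed

text \<open>
Algebraic independence along a tower of ideals, in the form needed for counting: distinct monomials in
\<open>y k, \<dots>, y (d - 1)\<close> are linearly independent modulo \<open>L k\<close>. From a relation modulo \<open>L k\<close>, cancel the smallest
power of \<open>y k\<close> that occurs. Modulo \<open>L (k + 1)\<close>, which contains \<open>y k\<close>, the terms with exactly that power remain,
and they form a relation between monomials in \<open>y (k + 1), \<dots>, y (d - 1)\<close>.
\<close>

lemma tower_monomials_independent: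
  fixes y :: "nat \<Rightarrow> ('v \<Rightarrow>\<^sub>0 nat) \<Rightarrow>\<^sub>0 'k::field" and c :: "(nat \<Rightarrow> nat) \<Rightarrow> 'k"
  assumes ideal: "\<And>k. k \<le> d \<Longrightarrow> ideal (L k) (mpoly_ring V)"
    and nzd: "\<And>k g. k < d \<Longrightarrow> g \<in> carrier (mpoly_ring V) \<Longrightarrow> y k * g \<in> L k \<Longrightarrow> g \<in> L k"
    and mem: "\<And>k. k < d \<Longrightarrow> y k \<in> L (Suc k)"
    and sub: "\<And>k. k < d \<Longrightarrow> L k \<subseteq> L (Suc k)"
    and proper: "L d \<noteq> carrier (mpoly_ring V)"
    and "k \<le> d" "finite A" "inj_on (\<lambda>a. restrict a {k..<d}) A"
    and "(\<Sum>a\<in>A. Poly_Mapping.single 0 (c a) * (\<Prod>i\<in>{k..<d}. y i ^ a i)) \<in> L k"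
    and "a \<in> A"
  shows "c a = 0"
  using \<open>k \<le> d\<close> assms(7-)
proof (induction k arbitrary: A a rule: inc_induct)
  case base
  have "A = {a}" using base(2,4) by (auto simp: inj_on_def)
  then have "Poly_Mapping.single 0 (c a) \<in> L d" using base(3) by simp
  then show ?case by (rule ideal_mpoly_ring_no_const[OF ideal[OF order_refl] proper])
next
  case (step k)
  have kd: "k < d" "k \<le> d" "Suc k \<le> d" using step.hyps by auto
  note I = ideal_mpoly_ring_closed[OF ideal[OF kd(2)]]
  note I' = ideal_mpoly_ring_closed[OF ideal[OF kd(3)]]
  have y_carrier: "y i \<in> carrier (mpoly_ring V)" if "i < d" for i
    using mem[OF that] ideal_mpoly_ring_closed(2)[OF ideal[of "Suc i"]] that by simp
  have tail_carrier: "Poly_Mapping.single 0 (c a) * (\<Prod>i\<in>{Suc k..<d}. y i ^ a i) \<in> carrier (mpoly_ring V)" for a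
    by (intro mpoly_ring_closed(2) const_in_mpoly_ring prod_in_mpoly_ring power_in_mpoly_ring y_carrier) auto
  define A' where "A' = {a \<in> A. c a \<noteq> 0}"
  show ?case
  proof (rule ccontr)
    assume "c a \<noteq> 0"
    then have A': "A' \<noteq> {}" "finite A'" using step.prems by (auto simp: A'_def)
    define m where "m = Min ((\<lambda>a. a k) ` A')"
    define B where "B = {a \<in> A'. a k = m}"
    have m_le: "m \<le> a k" if "a \<in> A'" for a using that A' by (simp add: m_def)
    have "m \<in> (\<lambda>a. a k) ` A'" unfolding m_def using A' by (intro Min_in) auto
    then have "B \<noteq> {}" by (auto simp: B_def)
    define t where "t a = Poly_Mapping.single 0 (c a) * (\<Prod>i\<in>{Suc k..<d}. y i ^ a i)" for a
    define G where "G = (\<Sum>a\<in>A'. y k ^ (a k - m) * t a)"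
    have t_carrier: "t a \<in> carrier (mpoly_ring V)" for a unfolding t_def by (rule tail_carrier)
    have G_carrier: "G \<in> carrier (mpoly_ring V)" unfolding G_def
      by (intro sum_in_mpoly_ring mpoly_ring_closed(2) power_in_mpoly_ring y_carrier t_carrier kd)
    have "(\<Sum>a\<in>A. Poly_Mapping.single 0 (c a) * (\<Prod>i\<in>{k..<d}. y i ^ a i))
        = (\<Sum>a\<in>A'. Poly_Mapping.single 0 (c a) * (\<Prod>i\<in>{k..<d}. y i ^ a i))"
      using step.prems(1) by (intro sum.mono_neutral_right) (auto simp: A'_def)
    also have "\<dots> = y k ^ m * G"
      unfolding G_def sum_distrib_left
    proof (intro sum.cong refl)
      fix a assume "a \<in> A'"
      then have "y k ^ a k = y k ^ m * y k ^ (a k - m)" using m_le[of a] by (simp flip: power_add)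
      then show "Poly_Mapping.single 0 (c a) * (\<Prod>i\<in>{k..<d}. y i ^ a i) = y k ^ m * (y k ^ (a k - m) * t a)"
        using kd(1) by (simp add: t_def prod.atLeast_Suc_lessThan algebra_simps)
    qed
    finally have "y k ^ m * G \<in> L k" using step.prems(3) by simp
    then have "G \<in> L k"
    proof (induction m)
      case (Suc m)
      have "y k * (y k ^ m * G) \<in> L k" using Suc.prems by (simp add: algebra_simps)
      moreover have "y k ^ m * G \<in> carrier (mpoly_ring V)"
        by (intro mpoly_ring_closed(2) power_in_mpoly_ring y_carrier kd G_carrier)
      ultimately show ?case using Suc.IH nzd[OF kd(1)] by blast
    qed simp
    then have G: "G \<in> L (Suc k)" using sub[OF kd(1)] by blast
    have high: "y k ^ (a k - m) * t a \<in> L (Suc k)" if "a \<in> A' - B" for a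
    proof -
      have "a k - m = Suc (a k - m - 1)" using that m_le[of a] by (auto simp: B_def)
      then have "y k ^ (a k - m) = y k * y k ^ (a k - m - 1)" by (metis power_Suc)
      then show ?thesis
        using I'(6)[OF mem[OF kd(1)], of "y k ^ (a k - m - 1) * t a"]
          mpoly_ring_closed(2)[OF power_in_mpoly_ring[OF y_carrier[OF kd(1)]] t_carrier]
        by (simp add: mult.assoc)
    qed
    have "(\<Sum>a\<in>A' - B. y k ^ (a k - m) * t a) \<in> L (Suc k)"
      by (intro ideal_mpoly_ring_sum[OF ideal[OF kd(3)]] high)
    then have "G - (\<Sum>a\<in>A' - B. y k ^ (a k - m) * t a) \<in> L (Suc k)" using I'(5) G by blast
    also have "G - (\<Sum>a\<in>A' - B. y k ^ (a k - m) * t a) = (\<Sum>a\<in>B. y k ^ (a k - m) * t a)"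
      unfolding G_def using A'(2) sum.subset_diff[of B A' "\<lambda>a. y k ^ (a k - m) * t a"] by (auto simp: B_def)
    also have "\<dots> = (\<Sum>a\<in>B. Poly_Mapping.single 0 (c a) * (\<Prod>i\<in>{Suc k..<d}. y i ^ a i))"
      by (intro sum.cong) (auto simp: B_def t_def)
    finally have B_sum: "(\<Sum>a\<in>B. Poly_Mapping.single 0 (c a) * (\<Prod>i\<in>{Suc k..<d}. y i ^ a i)) \<in> L (Suc k)" .
    have B_inj: "inj_on (\<lambda>a. restrict a {Suc k..<d}) B"
    proof (rule inj_onI)
      fix a b assume ab: "a \<in> B" "b \<in> B" "restrict a {Suc k..<d} = restrict b {Suc k..<d}"
      have "restrict a {k..<d} i = restrict b {k..<d} i" for i
        using ab(1,2) fun_cong[OF ab(3), of i] by (cases "i = k") (auto simp: B_def restrict_def)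
      then have "restrict a {k..<d} = restrict b {k..<d}" by blast
      then show "a = b" using step.prems(2) ab(1,2) unfolding inj_on_def B_def A'_def by blast
    qed
    obtain b where "b \<in> B" using \<open>B \<noteq> {}\<close> by blast
    moreover have "finite B" using A'(2) by (simp add: B_def)
    ultimately have "c b = 0" using step.IH[OF _ B_inj B_sum] by blast
    then show False using \<open>b \<in> B\<close> by (simp add: B_def A'_def)
  qed
qed

definition exponents_le :: "nat \<Rightarrow> (('v \<Rightarrow>\<^sub>0 nat) \<Rightarrow>\<^sub>0 'k::zero) \<Rightarrow> bool" where
  "exponents_le B p \<longleftrightarrow> (\<forall>m\<in>Poly_Mapping.keys p. \<forall>v. Poly_Mapping.lookup m v \<le> B)"

lemma exponents_le_times:
  fixes p q :: "('v \<Rightarrow>\<^sub>0 nat) \<Rightarrow>\<^sub>0 'k::comm_ring_1"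
  assumes "exponents_le B p" "exponents_le C q"
  shows "exponents_le (B + C) (p * q)"
  unfolding exponents_le_def
proof (intro ballI allI)
  fix m v assume "m \<in> Poly_Mapping.keys (p * q)"
  then obtain a b where "a \<in> Poly_Mapping.keys p" "b \<in> Poly_Mapping.keys q" "m = a + b"
    using keys_mult by blast
  then show "Poly_Mapping.lookup m v \<le> B + C"
    using assms by (auto simp: exponents_le_def lookup_add intro: add_mono)
qed

lemma exponents_le_one: "exponents_le B (1 :: ('v \<Rightarrow>\<^sub>0 nat) \<Rightarrow>\<^sub>0 'k::comm_ring_1)"
  by (simp add: exponents_le_def)

lemma exponents_le_power:
  fixes p :: "('v \<Rightarrow>\<^sub>0 nat) \<Rightarrow>\<^sub>0 'k::comm_ring_1"
  shows "exponents_le B p \<Longrightarrow> exponents_le (k * B) (p ^ k)"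
  by (induction k) (auto intro: exponents_le_one exponents_le_times)

lemma exponents_le_prod:
  fixes p :: "'a \<Rightarrow> ('v \<Rightarrow>\<^sub>0 nat) \<Rightarrow>\<^sub>0 'k::comm_ring_1"
  shows "(\<And>i. i \<in> A \<Longrightarrow> exponents_le B (p i)) \<Longrightarrow> exponents_le (card A * B) (\<Prod>i\<in>A. p i)"
  by (induction A rule: infinite_finite_induct)
     (auto intro: exponents_le_one exponents_le_times)

lemma exponents_le_mono: "exponents_le B p \<Longrightarrow> B \<le> C \<Longrightarrow> exponents_le C p"
  unfolding exponents_le_def by (meson order_trans)

lemma exponents_le_exists: "\<exists>B. exponents_le B p"
proof -
  have "finite (\<Union>m\<in>Poly_Mapping.keys p. Poly_Mapping.lookup m ` Poly_Mapping.keys m)" by simp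
  then obtain B where "\<And>x. x \<in> (\<Union>m\<in>Poly_Mapping.keys p. Poly_Mapping.lookup m ` Poly_Mapping.keys m) \<Longrightarrow> x \<le> B"
    using finite_nat_set_iff_bounded_le by meson
  then have "Poly_Mapping.lookup m v \<le> B" if "m \<in> Poly_Mapping.keys p" for m v
    using that by (cases "v \<in> Poly_Mapping.keys m") (blast, simp add: in_keys_iff)
  then show ?thesis by (auto simp: exponents_le_def)
qed

definition monomial_box :: "'v set \<Rightarrow> nat \<Rightarrow> ('v \<Rightarrow>\<^sub>0 nat) set" where
  "monomial_box V B = {m. Poly_Mapping.keys m \<subseteq> V \<and> (\<forall>v. Poly_Mapping.lookup m v \<le> B)}"

lemma card_monomial_box:
  assumes "finite V"
  shows "finite (monomial_box V B)" "card (monomial_box V B) \<le> (B + 1) ^ card V"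
proof -
  let ?r = "\<lambda>m. restrict (Poly_Mapping.lookup m) V"
  have inj: "inj_on ?r (monomial_box V B)"
  proof (rule inj_onI, rule poly_mapping_eqI)
    fix a b v assume ab: "a \<in> monomial_box V B" "b \<in> monomial_box V B" and eq: "?r a = ?r b"
    show "Poly_Mapping.lookup a v = Poly_Mapping.lookup b v"
    proof (cases "v \<in> V")
      case True
      then show ?thesis using fun_cong[OF eq, of v] by simp
    next
      case False
      then have "v \<notin> Poly_Mapping.keys a" "v \<notin> Poly_Mapping.keys b"
        using ab by (auto simp: monomial_box_def)
      then show ?thesis by (simp add: in_keys_iff)
    qed
  qed
  have sub: "?r ` monomial_box V B \<subseteq> V \<rightarrow>\<^sub>E {..B}" by (auto simp: monomial_box_def)
  have fin: "finite (V \<rightarrow>\<^sub>E {..B})" using assms by (intro finite_PiE) auto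
  show "finite (monomial_box V B)" using inj sub fin by (meson finite_imageD finite_subset)
  show "card (monomial_box V B) \<le> (B + 1) ^ card V"
    using card_inj_on_le[OF inj sub fin] assms by (simp add: card_PiE)
qed

text \<open>
Let \<open>N = card V\<close>. The \<open>M ^ d\<close> monomials in the elements \<open>y i\<close> with exponents below \<open>M\<close> are linearly
independent, and their exponents in each indeterminate are at most \<open>d * M * D\<close>, where \<open>D\<close> bounds the exponents
in all \<open>y i\<close>. They live in a space of dimension at most \<open>(d * M * D + 1) ^ N\<close>, which for large \<open>M\<close> is smaller
than \<open>M ^ (N + 1)\<close>.
\<close>

theorem tower_length_le_card:
  fixes y :: "nat \<Rightarrow> ('v \<Rightarrow>\<^sub>0 nat) \<Rightarrow>\<^sub>0 'k::field"
  assumes "finite V"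
    and ideal: "\<And>k. k \<le> d \<Longrightarrow> ideal (L k) (mpoly_ring V)"
    and nzd: "\<And>k g. k < d \<Longrightarrow> g \<in> carrier (mpoly_ring V) \<Longrightarrow> y k * g \<in> L k \<Longrightarrow> g \<in> L k"
    and mem: "\<And>k. k < d \<Longrightarrow> y k \<in> L (Suc k)"
    and sub: "\<And>k. k < d \<Longrightarrow> L k \<subseteq> L (Suc k)"
    and proper: "L d \<noteq> carrier (mpoly_ring V)"
  shows "d \<le> card V"
proof (rule ccontr)
  assume "\<not> d \<le> card V"
  then have d: "Suc (card V) \<le> d" by simp
  have y_carrier: "y i \<in> carrier (mpoly_ring V)" if "i < d" for i
    using mem[OF that] ideal_mpoly_ring_closed(2)[OF ideal[of "Suc i"]] that by simp
  have "\<forall>i. \<exists>B. exponents_le B (y i)" using exponents_le_exists by blast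
  then obtain b where b: "\<And>i. exponents_le (b i) (y i)" by metis
  define D where "D = Max (b ` {..<d})"
  have D: "exponents_le D (y i)" if "i < d" for i
    using exponents_le_mono[OF b[of i]] that by (simp add: D_def)
  \<comment> \<open>With this \<open>M\<close>, the factor \<open>(d * D + 1) ^ card V\<close> in the estimate of the dimension is below \<open>M\<close>.\<close>
  define M where "M = Suc ((d * D + 1) ^ card V)"
  define A where "A = {..<d} \<rightarrow>\<^sub>E {..<M}"
  define mon where "mon a = (\<Prod>i\<in>{0..<d}. y i ^ a i)" for a :: "nat \<Rightarrow> nat"
  define Box where "Box = monomial_box V (d * (M * D))"
  have A: "finite A" "card A = M ^ d" by (auto simp: A_def card_PiE intro!: finite_PiE)
  have A_inj: "inj_on (\<lambda>a. restrict a {0..<d}) A"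
    by (rule inj_onI) (auto simp: A_def atLeast0LessThan PiE_restrict)
  have mon_independent: "c a = 0"
    if "A' \<subseteq> A" "(\<Sum>a\<in>A'. Poly_Mapping.single 0 (c a) * mon a) = 0" "a \<in> A'" for A' c a
  proof (rule tower_monomials_independent[of d L V y 0 A' c a, OF ideal nzd mem sub proper])
    show "finite A'" using that(1) A(1) finite_subset by blast
    show "inj_on (\<lambda>a. restrict a {0..<d}) A'" using inj_on_subset[OF A_inj that(1)] .
    show "(\<Sum>a\<in>A'. Poly_Mapping.single 0 (c a) * (\<Prod>i = 0..<d. y i ^ a i)) \<in> L 0"
      using that(2) ideal_mpoly_ring_closed(1)[OF ideal[of 0]] by (simp add: mon_def)
  qed (use that in auto)
  have mon_inj: "inj_on mon A"
  proof (rule inj_onI, rule ccontr)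
    fix a b assume ab: "a \<in> A" "b \<in> A" "mon a = mon b" "a \<noteq> b"
    have "(\<Sum>x\<in>{a, b}. Poly_Mapping.single 0 (if x = a then 1 else - 1 :: 'k) * mon x) = 0"
      using ab(3,4) by (simp add: single_uminus)
    then have "(if a = a then 1 else - 1 :: 'k) = 0"
      using ab by (intro mon_independent[of "{a, b}" "\<lambda>x. if x = a then 1 else - 1"]) auto
    then show False by simp
  qed
  interpret vs: vector_space "\<lambda>(c::'k) (p::('v \<Rightarrow>\<^sub>0 nat) \<Rightarrow>\<^sub>0 'k). Poly_Mapping.single 0 c * p"
    by unfold_locales (auto simp: algebra_simps single_add mult_single)
  have mon_span: "mon a \<in> vs.span ((\<lambda>m. Poly_Mapping.single m 1) ` Box)" if a: "a \<in> A" for a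
  proof -
    have "exponents_le (card {0..<d} * (M * D)) (mon a)"
      unfolding mon_def
    proof (rule exponents_le_prod)
      fix i assume i: "i \<in> {0..<d}"
      then have "a i \<le> M" using a by (auto simp: A_def PiE_def Pi_def less_imp_le)
      then have "a i * D \<le> M * D" by (rule mult_le_mono1)
      then show "exponents_le (M * D) (y i ^ a i)"
        using exponents_le_mono[OF exponents_le_power[OF D[of i]]] i by simp
    qed
    moreover have "mon a \<in> carrier (mpoly_ring V)"
      unfolding mon_def by (intro prod_in_mpoly_ring power_in_mpoly_ring y_carrier) simp
    ultimately have keys: "Poly_Mapping.keys (mon a) \<subseteq> Box"
      by (auto simp: Box_def monomial_box_def exponents_le_def carrier_mpoly_ring)
    have "(\<Sum>m\<in>Poly_Mapping.keys (mon a). Poly_Mapping.single m (Poly_Mapping.lookup (mon a) m))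
        \<in> vs.span ((\<lambda>m. Poly_Mapping.single m 1) ` Box)"
    proof (rule vs.span_sum)
      fix m assume "m \<in> Poly_Mapping.keys (mon a)"
      then have "Poly_Mapping.single m 1 \<in> vs.span ((\<lambda>m. Poly_Mapping.single m 1) ` Box)"
        using keys by (intro vs.span_base) auto
      from vs.span_scale[OF this, of "Poly_Mapping.lookup (mon a) m"]
      show "Poly_Mapping.single m (Poly_Mapping.lookup (mon a) m) \<in> vs.span ((\<lambda>m. Poly_Mapping.single m 1) ` Box)"
        by (simp add: mult_single)
    qed
    then show ?thesis by (simp flip: poly_eq_sum_terms)
  qed
  have "\<not> vs.dependent (mon ` A)"
  proof
    assume "vs.dependent (mon ` A)"
    then obtain u where u: "\<exists>v\<in>mon ` A. u v \<noteq> 0" "(\<Sum>v\<in>mon ` A. Poly_Mapping.single 0 (u v) * v) = 0"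
      using vs.dependent_finite[of "mon ` A"] A(1) by auto
    then have "(\<Sum>a\<in>A. Poly_Mapping.single 0 (u (mon a)) * mon a) = 0"
      by (simp add: sum.reindex[OF mon_inj])
    then show False using mon_independent[of A "\<lambda>a. u (mon a)"] u(1) by auto
  qed
  then have "card (mon ` A) \<le> card ((\<lambda>m. Poly_Mapping.single m (1::'k)) ` Box)"
    using vs.independent_span_bound[of "(\<lambda>m. Poly_Mapping.single m 1) ` Box" "mon ` A"]
      card_monomial_box(1)[OF assms(1)] mon_span by (auto simp: Box_def)
  also have "\<dots> \<le> card Box"
    using card_monomial_box(1)[OF assms(1)] by (auto simp: Box_def intro: card_image_le)
  also have "\<dots> \<le> (d * (M * D) + 1) ^ card V"
    unfolding Box_def by (rule card_monomial_box(2)[OF assms(1)])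
  also have "\<dots> \<le> (M * (d * D + 1)) ^ card V"
    by (intro power_mono) (auto simp: M_def algebra_simps)
  also have "\<dots> < M ^ card V * M"
    unfolding power_mult_distrib by (intro mult_strict_left_mono) (auto simp: M_def)
  also have "\<dots> = M ^ Suc (card V)" by simp
  also have "\<dots> \<le> M ^ d" using d by (intro power_increasing) (auto simp: M_def)
  finally show False using A(2) card_image[OF mon_inj] by simp
qed

text \<open>
The ideals generated by the initial segments of the regular sequence, continued by the primes of the chain, form
a tower: an entry of the sequence is a nonzerodivisor modulo the ideal of its predecessors, and an element outside
a prime ideal is a nonzerodivisor modulo that ideal.
\<close>

theorem prime_chain_length_le:
  fixes fs :: "(('v \<Rightarrow>\<^sub>0 nat) \<Rightarrow>\<^sub>0 'k::field) list"
  assumes "finite V" "regular_sequence (mpoly_ring V) fs"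
    and "prime_chain (mpoly_ring V) d P" "genideal (mpoly_ring V) (set fs) \<subseteq> P 0"
  shows "d + length fs \<le> card V"
proof -
  let ?R = "mpoly_ring V :: (('v \<Rightarrow>\<^sub>0 nat) \<Rightarrow>\<^sub>0 'k) ring"
  interpret cring ?R by (rule cring_mpoly_ring)
  define n where "n = length fs"
  define I where "I i = genideal ?R (set (take i fs))" for i
  have fs_carrier: "set fs \<subseteq> carrier ?R" using assms(2) by (simp add: regular_sequence_def)
  then have take_carrier: "set (take i fs) \<subseteq> carrier ?R" for i
    using set_take_subset[of i fs] by blast
  have I_ideal: "ideal (I i) ?R" for i unfolding I_def by (rule genideal_ideal[OF take_carrier])
  have P: "primeideal (P i) ?R" if "i \<le> d" for i
    using assms(3) that by (simp add: prime_chain_def)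
  have "\<exists>x. x \<in> P (Suc i) - P i" if "i < d" for i
    using assms(3) that by (auto simp: prime_chain_def)
  then obtain x where x: "\<And>i. i < d \<Longrightarrow> x i \<in> P (Suc i) - P i" by metis
  \<comment> \<open>The ideal of the whole sequence is left out of the tower: its last entry lies in \<open>P 0\<close>, which is the next step.\<close>
  define L where "L k = (if k < n then I k else P (k - n))" for k
  define y where "y k = (if k < n then fs ! k else x (k - n))" for k
  have I_mono: "I k \<subseteq> I (Suc k)" for k
    unfolding I_def using set_take_subset_set_take[of k "Suc k" fs]
    by (intro genideal_minimal genideal_ideal subset_trans[OF _ genideal_self] take_carrier) auto
  have I_mem: "fs ! k \<in> I (Suc k)" if "k < n" for k
  proof -
    have "fs ! k \<in> set (take (Suc k) fs)"
      using that by (simp add: n_def take_Suc_conv_app_nth)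
    then show ?thesis unfolding I_def using genideal_self[OF take_carrier] by blast
  qed
  have I_n: "I n \<subseteq> P 0" using assms(4) by (simp add: I_def n_def)
  have "d + n \<le> card V"
  proof (rule tower_length_le_card[OF assms(1), of "d + n" L y])
    fix k assume "k \<le> d + n"
    then show "ideal (L k) ?R"
      using I_ideal[of k] primeideal.axioms(1)[OF P[of "k - n"]] by (auto simp: L_def)
  next
    fix k g assume k: "k < d + n" and g: "g \<in> carrier ?R" "y k * g \<in> L k"
    show "g \<in> L k"
    proof (cases "k < n")
      case True
      have nzd: "nonzerodivisor (?R Quot I k) (I k +>\<^bsub>?R\<^esub> (fs ! k))"
        using assms(2) True by (simp add: regular_sequence_def I_def n_def Let_def)
      have "fs ! k \<in> carrier ?R" using fs_carrier True by (auto simp: n_def)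
      with nzd show ?thesis
        using g True by (simp add: nonzerodivisor_Quot_iff[OF cring_mpoly_ring I_ideal] L_def y_def)
    next
      case False
      then have i: "k - n < d" using k by simp
      interpret Pi: primeideal "P (k - n)" ?R using P i by simp
      interpret Pi': primeideal "P (Suc (k - n))" ?R using P i by simp
      have "x (k - n) \<in> P (k - n) \<or> g \<in> P (k - n)"
        using Pi.I_prime[of "x (k - n)" g] g False Pi'.Icarr[of "x (k - n)"] x[OF i]
        by (simp add: L_def y_def)
      then show ?thesis using x[OF i] False by (simp add: L_def)
    qed
  next
    fix k assume k: "k < d + n"
    consider "Suc k < n" | "Suc k = n" | "n \<le> k" by linarith
    then show "y k \<in> L (Suc k)"
    proof cases
      case 2
      then show ?thesis using I_mem[of k] I_n by (auto simp: L_def y_def)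
    next
      case 3
      then show ?thesis using x[of "k - n"] k by (auto simp: L_def y_def Suc_diff_le)
    qed (use I_mem[of k] in \<open>auto simp: L_def y_def\<close>)
  next
    fix k assume k: "k < d + n"
    consider "Suc k < n" | "Suc k = n" | "n \<le> k" by linarith
    then show "L k \<subseteq> L (Suc k)"
    proof cases
      case 2
      then show ?thesis using I_mono[of k] I_n by (auto simp: L_def)
    next
      case 3
      then have "P (k - n) \<subset> P (Suc (k - n))" using assms(3) k by (simp add: prime_chain_def)
      then show ?thesis using 3 by (auto simp: L_def Suc_diff_le)
    qed (use I_mono[of k] in \<open>auto simp: L_def\<close>)
  next
    show "L (d + n) \<noteq> carrier ?R"
      using primeideal.I_notcarr[OF P[of d]] by (auto simp: L_def)
  qed
  then show ?thesis by (simp add: n_def)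
qed

section \<open>Chains of primes from polynomial parametrizations\<close>

definition monomial_subst :: "('v \<Rightarrow> 'b::comm_ring_1) \<Rightarrow> ('v \<Rightarrow>\<^sub>0 nat) \<Rightarrow> 'b" where
  "monomial_subst \<sigma> m = (\<Prod>v\<in>Poly_Mapping.keys m. \<sigma> v ^ Poly_Mapping.lookup m v)"

definition poly_subst ::
    "('v \<Rightarrow> ('w \<Rightarrow>\<^sub>0 nat) \<Rightarrow>\<^sub>0 'k) \<Rightarrow> (('v \<Rightarrow>\<^sub>0 nat) \<Rightarrow>\<^sub>0 'k::field) \<Rightarrow> ('w \<Rightarrow>\<^sub>0 nat) \<Rightarrow>\<^sub>0 'k" where
  "poly_subst \<sigma> p =
     (\<Sum>m\<in>Poly_Mapping.keys p. Poly_Mapping.single 0 (Poly_Mapping.lookup p m) * monomial_subst \<sigma> m)"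

lemma monomial_subst_superset:
  "finite S \<Longrightarrow> Poly_Mapping.keys m \<subseteq> S \<Longrightarrow> monomial_subst \<sigma> m = (\<Prod>v\<in>S. \<sigma> v ^ Poly_Mapping.lookup m v)"
  unfolding monomial_subst_def by (rule prod.mono_neutral_left) (auto simp: in_keys_iff)

lemma monomial_subst_add: "monomial_subst \<sigma> (a + b) = monomial_subst \<sigma> a * monomial_subst \<sigma> b"
proof -
  let ?S = "Poly_Mapping.keys a \<union> Poly_Mapping.keys b"
  show ?thesis
    using monomial_subst_superset[of ?S a \<sigma>] monomial_subst_superset[of ?S b \<sigma>]
      monomial_subst_superset[of ?S "a + b" \<sigma>] Poly_Mapping.keys_add[of a b]
    by (simp add: lookup_add power_add prod.distrib)
qed

lemma poly_subst_superset:
  assumes "finite S" "Poly_Mapping.keys p \<subseteq> S"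
  shows "poly_subst \<sigma> p = (\<Sum>m\<in>S. Poly_Mapping.single 0 (Poly_Mapping.lookup p m) * monomial_subst \<sigma> m)"
  unfolding poly_subst_def using assms by (intro sum.mono_neutral_left) (auto simp: in_keys_iff)

lemma poly_subst_single: "poly_subst \<sigma> (Poly_Mapping.single m c) = Poly_Mapping.single 0 c * monomial_subst \<sigma> m"
  by (simp add: poly_subst_superset[of "{m}"])

lemma poly_subst_0 [simp]: "poly_subst \<sigma> 0 = 0"
  by (simp add: poly_subst_def)

lemma poly_subst_1 [simp]: "poly_subst \<sigma> 1 = 1"
  using poly_subst_single[of \<sigma> 0 1] by (simp add: monomial_subst_def)

lemma poly_subst_const [simp]: "poly_subst \<sigma> (Poly_Mapping.single 0 c) = Poly_Mapping.single 0 c"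
  by (simp add: poly_subst_single monomial_subst_def)

lemma poly_subst_indet [simp]: "poly_subst \<sigma> (indet_poly v) = \<sigma> v"
  by (simp add: indet_poly_def poly_subst_single monomial_subst_def)

lemma poly_subst_add [simp]: "poly_subst \<sigma> (p + q) = poly_subst \<sigma> p + poly_subst \<sigma> q"
proof -
  let ?S = "Poly_Mapping.keys p \<union> Poly_Mapping.keys q"
  show ?thesis
    using poly_subst_superset[of ?S p \<sigma>] poly_subst_superset[of ?S q \<sigma>]
      poly_subst_superset[of ?S "p + q" \<sigma>] Poly_Mapping.keys_add[of p q]
    by (simp add: lookup_add single_add distrib_right sum.distrib)
qed

lemma poly_subst_sum [simp]: "poly_subst \<sigma> (\<Sum>i\<in>A. f i) = (\<Sum>i\<in>A. poly_subst \<sigma> (f i))"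
  by (induction A rule: infinite_finite_induct) auto

lemma poly_subst_mult [simp]:
  fixes \<sigma> :: "'v \<Rightarrow> ('w \<Rightarrow>\<^sub>0 nat) \<Rightarrow>\<^sub>0 'k::field"
  shows "poly_subst \<sigma> (p * q) = poly_subst \<sigma> p * poly_subst \<sigma> q"
proof -
  let ?t = "\<lambda>p m. Poly_Mapping.single m (Poly_Mapping.lookup p m)"
  have terms: "poly_subst \<sigma> (Poly_Mapping.single a c * Poly_Mapping.single b d)
      = poly_subst \<sigma> (Poly_Mapping.single a c) * poly_subst \<sigma> (Poly_Mapping.single b d)" for a b c d
  proof -
    have "Poly_Mapping.single 0 (c * d) = (Poly_Mapping.single 0 c * Poly_Mapping.single 0 d :: ('w \<Rightarrow>\<^sub>0 nat) \<Rightarrow>\<^sub>0 'k)"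
      by (simp add: mult_single)
    then show ?thesis
      by (subst mult_single) (simp only: poly_subst_single monomial_subst_add ac_simps)
  qed
  have "poly_subst \<sigma> (p * q)
    = poly_subst \<sigma> ((\<Sum>a\<in>Poly_Mapping.keys p. ?t p a) * (\<Sum>b\<in>Poly_Mapping.keys q. ?t q b))"
    by (simp flip: poly_eq_sum_terms)
  also have "\<dots> = (\<Sum>a\<in>Poly_Mapping.keys p. \<Sum>b\<in>Poly_Mapping.keys q.
      poly_subst \<sigma> (?t p a) * poly_subst \<sigma> (?t q b))"
    by (simp only: sum_product poly_subst_sum terms)
  also have "\<dots> = poly_subst \<sigma> p * poly_subst \<sigma> q"
    by (simp only: poly_subst_single sum_product poly_subst_def[of \<sigma> p] poly_subst_def[of \<sigma> q])
  finally show ?thesis .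
qed

lemma poly_subst_uminus [simp]: "poly_subst \<sigma> (- p) = - poly_subst \<sigma> p"
proof -
  have "poly_subst \<sigma> (- p) + poly_subst \<sigma> p = poly_subst \<sigma> (- p + p)"
    by (simp only: poly_subst_add)
  then show ?thesis by (simp add: eq_neg_iff_add_eq_0)
qed

lemma poly_subst_diff [simp]: "poly_subst \<sigma> (p - q) = poly_subst \<sigma> p - poly_subst \<sigma> q"
  using poly_subst_add[of \<sigma> p "- q"] by simp

lemma poly_subst_prod [simp]: "poly_subst \<sigma> (\<Prod>i\<in>A. f i) = (\<Prod>i\<in>A. poly_subst \<sigma> (f i))"
  by (induction A rule: infinite_finite_induct) auto

lemma poly_subst_power [simp]: "poly_subst \<sigma> (p ^ k) = poly_subst \<sigma> p ^ k"
  by (induction k) auto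

lemma poly_subst_poly_subst:
  "poly_subst \<tau> (poly_subst \<sigma> p) = poly_subst (\<lambda>v. poly_subst \<tau> (\<sigma> v)) p"
  by (simp add: poly_subst_def[of \<sigma>] poly_subst_def[of "\<lambda>v. poly_subst \<tau> (\<sigma> v)"] monomial_subst_def)

text \<open>
The target has indeterminates indexed by \<open>nat\<close> because a linear order on the indeterminates makes the polynomial
ring an integral domain.
\<close>

lemma primeideal_subst_kernel:
  fixes \<sigma> :: "'v \<Rightarrow> (nat \<Rightarrow>\<^sub>0 nat) \<Rightarrow>\<^sub>0 'k::field"
  shows "primeideal {p \<in> carrier (mpoly_ring V). poly_subst \<sigma> p = 0} (mpoly_ring V)"
proof -
  interpret cring "mpoly_ring V :: (('v \<Rightarrow>\<^sub>0 nat) \<Rightarrow>\<^sub>0 'k) ring" by (rule cring_mpoly_ring)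
  have inv: "\<ominus>\<^bsub>mpoly_ring V\<^esub> p = - p" if "p \<in> carrier (mpoly_ring V)" for p :: "('v \<Rightarrow>\<^sub>0 nat) \<Rightarrow>\<^sub>0 'k"
    using that mpoly_ring_closed(3)[OF that that] by (intro minus_equality) auto
  show ?thesis
  proof (rule primeidealI2)
    let ?K = "{p \<in> carrier (mpoly_ring V). poly_subst \<sigma> p = 0}"
    have "subgroup ?K (add_monoid (mpoly_ring V))"
    proof (rule add.subgroupI)
      have "0 \<in> ?K" by simp
      then show "?K \<noteq> {}" by blast
      show "\<ominus>\<^bsub>mpoly_ring V\<^esub> p \<in> ?K" if "p \<in> ?K" for p
        using that inv[of p] mpoly_ring_closed(3)[of p V p] by simp
      show "p \<oplus>\<^bsub>mpoly_ring V\<^esub> q \<in> ?K" if "p \<in> ?K" "q \<in> ?K" for p q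
        using that mpoly_ring_closed(1)[of p V q] by simp
    qed blast
    then show "additive_subgroup ?K (mpoly_ring V)" by (rule additive_subgroup.intro)
    show "cring (mpoly_ring V :: (('v \<Rightarrow>\<^sub>0 nat) \<Rightarrow>\<^sub>0 'k) ring)" by (rule cring_mpoly_ring)
    have "1 \<notin> {p \<in> carrier (mpoly_ring V). poly_subst \<sigma> p = 0}" by simp
    then show "carrier (mpoly_ring V) \<noteq> {p \<in> carrier (mpoly_ring V). poly_subst \<sigma> p = 0}"
      using zero_one_in_mpoly_ring(2) by blast
  qed (auto intro: mpoly_ring_closed)
qed

text \<open>
Restriction to the coordinate subspace on which the first \<open>i\<close> coordinates vanish.
\<close>

definition kill_below :: "nat \<Rightarrow> ((nat \<Rightarrow>\<^sub>0 nat) \<Rightarrow>\<^sub>0 'k::field) \<Rightarrow> (nat \<Rightarrow>\<^sub>0 nat) \<Rightarrow>\<^sub>0 'k" where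
  "kill_below i = poly_subst (\<lambda>v. if v < i then 0 else indet_poly v)"

lemma kill_below_Suc: "kill_below (Suc i) (kill_below i p) = kill_below (Suc i) p"
proof -
  have "(\<lambda>v. poly_subst (\<lambda>v. if v < Suc i then 0 else indet_poly v) (if v < i then 0 else indet_poly v))
    = (\<lambda>v. if v < Suc i then 0 else indet_poly v :: (nat \<Rightarrow>\<^sub>0 nat) \<Rightarrow>\<^sub>0 'a)"
    by auto
  then show ?thesis by (simp add: kill_below_def poly_subst_poly_subst)
qed

text \<open>
Geometrically, the primes are the vanishing ideals of the closures of the images of smaller and smaller coordinate
subspaces. The hypothesis says that each restriction makes the image smaller.
\<close>

lemma prime_chain_of_parametrization:
  fixes \<phi> :: "'v \<Rightarrow> (nat \<Rightarrow>\<^sub>0 nat) \<Rightarrow>\<^sub>0 'k::field"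
  assumes "\<And>i. i < d \<Longrightarrow> \<exists>p\<in>carrier (mpoly_ring V).
      kill_below i (poly_subst \<phi> p) \<noteq> 0 \<and> kill_below (Suc i) (poly_subst \<phi> p) = 0"
  shows "prime_chain (mpoly_ring V) d
      (\<lambda>i. {p \<in> carrier (mpoly_ring V). kill_below i (poly_subst \<phi> p) = 0})"
  unfolding prime_chain_def
proof (intro conjI allI impI)
  fix i
  show "primeideal {p \<in> carrier (mpoly_ring V). kill_below i (poly_subst \<phi> p) = 0} (mpoly_ring V)"
    unfolding kill_below_def poly_subst_poly_subst by (rule primeideal_subst_kernel)
next
  fix i assume "i < d"
  have "kill_below (Suc i) (poly_subst \<phi> p) = 0" if "kill_below i (poly_subst \<phi> p) = 0" for p
    using kill_below_Suc[of i "poly_subst \<phi> p"] that by (simp add: kill_below_def)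
  then show "{p \<in> carrier (mpoly_ring V). kill_below i (poly_subst \<phi> p) = 0}
    \<subset> {p \<in> carrier (mpoly_ring V). kill_below (Suc i) (poly_subst \<phi> p) = 0}"
    using assms[OF \<open>i < d\<close>] by blast
qed

section \<open>The Krull dimension of a quotient ring\<close>

lemma prime_chain_vimage_Quot:
  assumes "cring R" "ideal J R" "prime_chain (R Quot J) d Q"
  defines "P \<equiv> (\<lambda>i. {r \<in> carrier R. J +>\<^bsub>R\<^esub> r \<in> Q i})"
  shows "prime_chain R d P" "J \<subseteq> P 0"
proof -
  interpret cring R by fact
  interpret J: ideal J R by fact
  have Q: "primeideal (Q i) (R Quot J)" if "i \<le> d" for i
    using assms(3) that by (simp add: prime_chain_def)
  have "P i \<subset> P (Suc i)" if "i < d" for i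
  proof -
    have sub: "Q i \<subset> Q (Suc i)" using assms(3) that by (simp add: prime_chain_def)
    then obtain q where q: "q \<in> Q (Suc i)" "q \<notin> Q i" by blast
    then have "q \<in> carrier (R Quot J)"
      using ideal.Icarr[OF primeideal.axioms(1)[OF Q[of "Suc i"]]] that by simp
    then obtain r where r: "r \<in> carrier R" "q = J +>\<^bsub>R\<^esub> r"
      unfolding FactRing_def A_RCOSETS_def' by auto
    have "r \<in> P (Suc i)" "r \<notin> P i" using q r by (simp_all add: P_def)
    moreover have "P i \<subseteq> P (Suc i)" using sub unfolding P_def by blast
    ultimately show ?thesis by blast
  qed
  moreover have "primeideal (P i) R" if "i \<le> d" for i
    unfolding P_def by (rule ring_hom_ring.primeideal_vimage[OF J.rcos_ring_hom_ring assms(1) Q[OF that]])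
  ultimately show "prime_chain R d P" unfolding prime_chain_def by blast
  show "J \<subseteq> P 0"
  proof
    fix r assume r: "r \<in> J"
    then have "J +>\<^bsub>R\<^esub> r = \<zero>\<^bsub>R Quot J\<^esub>"
      using a_rcos_zero[OF assms(2) r] by (simp add: FactRing_def)
    moreover have "\<zero>\<^bsub>R Quot J\<^esub> \<in> Q 0"
      by (rule additive_subgroup.zero_closed[OF ideal.axioms(1)[OF primeideal.axioms(1)[OF Q]]]) simp
    ultimately show "r \<in> P 0" using J.Icarr[OF r] unfolding P_def by simp
  qed
qed

lemma prime_chain_image_Quot:
  assumes "cring R" "ideal J R" "prime_chain R d P" "J \<subseteq> P 0"
  shows "prime_chain (R Quot J) d (\<lambda>i. (+>\<^bsub>R\<^esub>) J ` P i)"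
proof -
  interpret cring R by fact
  interpret J: ideal J R by fact
  have P: "primeideal (P i) R" if "i \<le> d" for i
    using assms(3) that by (simp add: prime_chain_def)
  have J_sub: "J \<subseteq> P i" if "i \<le> d" for i
    using that
  proof (induction i)
    case (Suc i)
    then have "P i \<subset> P (Suc i)" using assms(3) by (simp add: prime_chain_def)
    then show ?case using Suc by auto
  qed (use assms(4) in simp)
  have carr: "carrier (R Quot J) = (+>\<^bsub>R\<^esub>) J ` carrier R"
    unfolding FactRing_def A_RCOSETS_def' by auto
  have mem: "J +>\<^bsub>R\<^esub> r \<in> (+>\<^bsub>R\<^esub>) J ` P i \<longleftrightarrow> r \<in> P i" if "i \<le> d" "r \<in> carrier R" for i r
  proof -
    have id: "ideal (P i) R" using P[OF that(1)] by (rule primeideal.axioms(1))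
    have "(+>\<^bsub>R\<^esub>) J ` P i \<subseteq> carrier (R Quot J)"
      unfolding carr using ideal.Icarr[OF id] by blast
    note mem_iff = canonical_proj_vimage_mem_iff[OF assms(2) this that(2)]
    have "P i = \<Union> ((+>\<^bsub>R\<^esub>) J ` P i)"
      using iffD1[OF ideal_incl_iff[OF assms(2) id] J_sub[OF that(1)]] .
    then show ?thesis using mem_iff by metis
  qed
  show ?thesis
    unfolding prime_chain_def
  proof (intro conjI allI impI)
    fix i assume i: "i \<le> d"
    interpret Pi: primeideal "P i" R by (rule P[OF i])
    show "primeideal ((+>\<^bsub>R\<^esub>) J ` P i) (R Quot J)"
    proof (rule primeidealI)
      show "ideal ((+>\<^bsub>R\<^esub>) J ` P i) (R Quot J)"
        by (rule ring_ideal_imp_quot_ideal[OF assms(2) Pi.is_ideal])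
      show "cring (R Quot J)" by (rule J.quotient_is_cring[OF assms(1)])
      obtain r where r: "r \<in> carrier R" "r \<notin> P i" using Pi.I_notcarr Pi.Icarr by blast
      then have "J +>\<^bsub>R\<^esub> r \<in> carrier (R Quot J)" "J +>\<^bsub>R\<^esub> r \<notin> (+>\<^bsub>R\<^esub>) J ` P i"
        using mem[OF i r(1)] by (simp_all add: carr)
      then show "carrier (R Quot J) \<noteq> (+>\<^bsub>R\<^esub>) J ` P i" by metis
      fix a b assume "a \<in> carrier (R Quot J)" "b \<in> carrier (R Quot J)"
        "a \<otimes>\<^bsub>R Quot J\<^esub> b \<in> (+>\<^bsub>R\<^esub>) J ` P i"
      moreover from this(1,2) obtain x y where xy: "x \<in> carrier R" "a = J +>\<^bsub>R\<^esub> x" "y \<in> carrier R" "b = J +>\<^bsub>R\<^esub> y"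
        unfolding carr by blast
      moreover have "a \<otimes>\<^bsub>R Quot J\<^esub> b = J +>\<^bsub>R\<^esub> (x \<otimes>\<^bsub>R\<^esub> y)"
        using J.rcoset_mult_add[OF xy(1,3)] xy(2,4) by (simp add: FactRing_def)
      ultimately have "x \<otimes>\<^bsub>R\<^esub> y \<in> P i" using mem[OF i m_closed[OF xy(1,3)]] by simp
      then have "x \<in> P i \<or> y \<in> P i" by (rule Pi.I_prime[OF xy(1,3)])
      then show "a \<in> (+>\<^bsub>R\<^esub>) J ` P i \<or> b \<in> (+>\<^bsub>R\<^esub>) J ` P i"
        unfolding xy(2,4) by (auto intro: imageI)
    qed
  next
    fix i assume i: "i < d"
    then have "P i \<subset> P (Suc i)" using assms(3) by (simp add: prime_chain_def)
    moreover have "P (Suc i) \<subseteq> carrier R"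
      using ideal.Icarr[OF primeideal.axioms(1)[OF P[of "Suc i"]]] i by auto
    ultimately obtain r where r: "r \<in> P (Suc i)" "r \<notin> P i" "r \<in> carrier R" and sub: "P i \<subseteq> P (Suc i)"
      by blast
    have "J +>\<^bsub>R\<^esub> r \<notin> (+>\<^bsub>R\<^esub>) J ` P i" using mem[of i r] r i by simp
    moreover have "J +>\<^bsub>R\<^esub> r \<in> (+>\<^bsub>R\<^esub>) J ` P (Suc i)" using r(1) by (rule imageI)
    ultimately show "(+>\<^bsub>R\<^esub>) J ` P i \<subset> (+>\<^bsub>R\<^esub>) J ` P (Suc i)"
      using image_mono[OF sub] by (metis psubsetI)
  qed
qed

lemma krull_dim_Quot_eqI:
  assumes "cring R" "ideal J R" "prime_chain R d P" "J \<subseteq> P 0"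
    and "\<And>d' P'. prime_chain R d' P' \<Longrightarrow> J \<subseteq> P' 0 \<Longrightarrow> d' \<le> d"
  shows "krull_dim (R Quot J) = ereal (real d)"
  unfolding krull_dim_def
proof (rule SUP_eqI)
  fix d' assume "d' \<in> {d. \<exists>P. prime_chain (R Quot J) d P}"
  then obtain Q where Q: "prime_chain (R Quot J) d' Q" by blast
  show "ereal (real d') \<le> ereal (real d)"
    using assms(5)[OF prime_chain_vimage_Quot[OF assms(1,2) Q]] by simp
next
  fix y assume "\<And>d'. d' \<in> {d. \<exists>P. prime_chain (R Quot J) d P} \<Longrightarrow> ereal (real d') \<le> y"
  moreover have "d \<in> {d. \<exists>P. prime_chain (R Quot J) d P}"
    using prime_chain_image_Quot[OF assms(1-4)] by (intro CollectI exI)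
  ultimately show "ereal (real d) \<le> y" .
qed

section \<open>The anti-diagonal of the commutator\<close>

definition antidiag_entry :: "nat \<Rightarrow> nat \<Rightarrow> (indet \<Rightarrow>\<^sub>0 nat) \<Rightarrow>\<^sub>0 'k::field" where
  "antidiag_entry n j = generic_commutator n $$ (j, n - 1 - j)"

lemma antidiag_entry_eq:
  assumes "j < n"
  shows "antidiag_entry n j =
    (\<Sum>k<n. indet_poly (IX j k) * indet_poly (IY k (n - 1 - j)) :: (indet \<Rightarrow>\<^sub>0 nat) \<Rightarrow>\<^sub>0 'k::field) -
    (\<Sum>k<n. indet_poly (IY j k) * indet_poly (IX k (n - 1 - j)))"
  using assms by (simp add: antidiag_entry_def generic_commutator_def generic_X_def generic_Y_def
    scalar_prod_def lessThan_atLeast0)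

lemma antidiag_entry_in_carrier: "j < n \<Longrightarrow> antidiag_entry n j \<in> carrier (mpoly_ring (indets n))"
  unfolding antidiag_entry_def by (rule generic_commutator_in_carrier) auto

lemma antidiag_ideal_eq:
  "(antidiag_ideal n :: ((indet \<Rightarrow>\<^sub>0 nat) \<Rightarrow>\<^sub>0 'k::field) set) = genideal (mpoly_ring (indets n)) (set (map (antidiag_entry n) [0..<n]))"
proof -
  have "{generic_commutator n $$ (i, n - 1 - i) | i. i < n}
      = (antidiag_entry n ` {..<n} :: ((indet \<Rightarrow>\<^sub>0 nat) \<Rightarrow>\<^sub>0 'k) set)"
    by (auto simp: antidiag_entry_def)
  then show ?thesis by (simp only: antidiag_ideal_def lessThan_atLeast0 set_map set_upt)
qed

lemma indets_eq:
  "indets n = (\<lambda>(i, j). IX i j) ` ({..<n} \<times> {..<n}) \<union> (\<lambda>(i, j). IY i j) ` ({..<n} \<times> {..<n})"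
  by (auto simp: indets_def)

lemma finite_indets: "finite (indets n)"
  by (simp add: indets_eq)

lemma card_indets: "card (indets n) = 2 * n\<^sup>2"
proof -
  have "card (indets n) = card ((\<lambda>(i, j). IX i j) ` ({..<n} \<times> {..<n})) + card ((\<lambda>(i, j). IY i j) ` ({..<n} \<times> {..<n}))"
    unfolding indets_eq by (rule card_Un_disjoint) auto
  also have "\<dots> = 2 * n\<^sup>2"
    by (subst (1 2) card_image) (auto simp: inj_on_def power2_eq_square)
  finally show ?thesis .
qed

definition xy_monomial :: "nat \<Rightarrow> nat \<Rightarrow> nat \<Rightarrow> nat \<Rightarrow> indet \<Rightarrow>\<^sub>0 nat" where
  "xy_monomial a b c d = Poly_Mapping.single (IX a b) 1 + Poly_Mapping.single (IY c d) 1"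

lemma xy_monomial_eq_iff [simp]: "xy_monomial a b c d = xy_monomial a' b' c' d' \<longleftrightarrow> a = a' \<and> b = b' \<and> c = c' \<and> d = d'"
proof
  assume eq: "xy_monomial a b c d = xy_monomial a' b' c' d'"
  have "Poly_Mapping.lookup (xy_monomial a b c d) v = Poly_Mapping.lookup (xy_monomial a' b' c' d') v" for v
    by (simp only: eq)
  from this[of "IX a b"] this[of "IY c d"] show "a = a' \<and> b = b' \<and> c = c' \<and> d = d'"
    by (auto simp: xy_monomial_def lookup_add lookup_single when_def split: if_splits)
qed simp

lemma lookup_antidiag_entry:
  assumes "j < n"
  shows "Poly_Mapping.lookup (antidiag_entry n j) m =
    (\<Sum>k<n. if xy_monomial j k k (n - 1 - j) = m then 1 else 0 :: 'k::field) -
    (\<Sum>k<n. if xy_monomial k (n - 1 - j) j k = m then 1 else 0)"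
proof -
  have "antidiag_entry n j = (\<Sum>k<n. Poly_Mapping.single (xy_monomial j k k (n - 1 - j)) 1)
      - (\<Sum>k<n. Poly_Mapping.single (xy_monomial k (n - 1 - j) j k) 1 :: (indet \<Rightarrow>\<^sub>0 nat) \<Rightarrow>\<^sub>0 'k)"
    unfolding antidiag_entry_eq[OF assms] by (simp add: xy_monomial_def indet_poly_def mult_single add.commute)
  then show ?thesis by (simp add: lookup_minus lookup_sum lookup_single when_def)
qed

text \<open>
The total degree in column \<open>0\<close> of \<open>X\<close> and row \<open>0\<close> of \<open>Y\<close>.
\<close>

definition border_weight :: "nat \<Rightarrow> (indet \<Rightarrow>\<^sub>0 nat) \<Rightarrow> nat" where
  "border_weight n m = (\<Sum>j<n. Poly_Mapping.lookup m (IX j 0) + Poly_Mapping.lookup m (IY 0 j))"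

lemma border_weight_xy_monomial:
  "border_weight n (xy_monomial a b c d) = (if b = 0 \<and> a < n then 1 else 0) + (if c = 0 \<and> d < n then 1 else 0)"
proof -
  have "border_weight n (xy_monomial a b c d)
    = (\<Sum>j<n. if j = a then if b = 0 then 1 else 0 else 0) + (\<Sum>j<n. if j = d then if c = 0 then 1 else 0 else 0)"
    unfolding border_weight_def sum.distrib[symmetric]
    by (intro sum.cong) (auto simp: xy_monomial_def lookup_add lookup_single when_def)
  then show ?thesis by simp
qed

text \<open>
In \<open>x j k * y k j'\<close> either both factors have weight 1, namely for \<open>k = 0\<close>, or neither does. In
\<open>y j k * x k j'\<close> both factors have weight 1 only if \<open>j = j' = 0\<close>, that is, for \<open>n = 1\<close>.
\<close>

lemma coprime_leading_antidiag:
  assumes "2 \<le> n"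
  shows "coprime_leading_monomials (indets n) (antidiag_entry n :: nat \<Rightarrow> (indet \<Rightarrow>\<^sub>0 nat) \<Rightarrow>\<^sub>0 'k::field)
    (\<lambda>j. xy_monomial j 0 0 (n - 1 - j)) (border_weight n) n"
proof
  show "border_weight n (a + b) = border_weight n a + border_weight n b" for a b
    by (simp add: border_weight_def lookup_add sum.distrib)
next
  fix j assume j: "j < n"
  show "antidiag_entry n j \<in> carrier (mpoly_ring (indets n))" by (rule antidiag_entry_in_carrier[OF j])
  have second: "\<not> (k = j \<and> n - 1 - j = 0 \<and> j = 0 \<and> k = n - 1 - j)" for k using assms j by auto
  have "(\<Sum>k<n. if xy_monomial j k k (n - 1 - j) = xy_monomial j 0 0 (n - 1 - j) then 1 else 0 :: 'k) = (\<Sum>k<n. if k = 0 then 1 else 0)"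
    by (intro sum.cong) auto
  moreover have "(\<Sum>k<n. if xy_monomial k (n - 1 - j) j k = xy_monomial j 0 0 (n - 1 - j) then 1 else 0 :: 'k) = 0"
    using second by (intro sum.neutral) (simp del: diff_is_0_eq)
  ultimately show "Poly_Mapping.lookup (antidiag_entry n j) (xy_monomial j 0 0 (n - 1 - j)) = (1 :: 'k)"
    unfolding lookup_antidiag_entry[OF j] using assms by simp
  fix m assume m: "m \<in> Poly_Mapping.keys (antidiag_entry n j :: (indet \<Rightarrow>\<^sub>0 nat) \<Rightarrow>\<^sub>0 'k)" "m \<noteq> xy_monomial j 0 0 (n - 1 - j)"
  have "\<exists>k<n. m = xy_monomial j k k (n - 1 - j) \<or> m = xy_monomial k (n - 1 - j) j k"
  proof (rule ccontr)
    assume "\<not> ?thesis"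
    then have "xy_monomial j k k (n - 1 - j) \<noteq> m" "xy_monomial k (n - 1 - j) j k \<noteq> m" if "k < n" for k using that by blast+
    then have "(\<Sum>k<n. if xy_monomial j k k (n - 1 - j) = m then 1 else 0 :: 'k) = 0"
      "(\<Sum>k<n. if xy_monomial k (n - 1 - j) j k = m then 1 else 0 :: 'k) = 0"
      by (auto intro!: sum.neutral simp del: diff_Suc_eq_diff_pred)
    then have "Poly_Mapping.lookup (antidiag_entry n j) m = (0::'k)"
      unfolding lookup_antidiag_entry[OF j] by (simp only: diff_self)
    then show False using m(1) by (simp add: in_keys_iff)
  qed
  then obtain k where k: "k < n" "m = xy_monomial j k k (n - 1 - j) \<or> m = xy_monomial k (n - 1 - j) j k" by blast
  have "border_weight n (xy_monomial j 0 0 (n - 1 - j)) = 2"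
    using j by (simp add: border_weight_xy_monomial)
  moreover have "border_weight n m < 2"
    using k(2)
  proof
    assume mk: "m = xy_monomial j k k (n - 1 - j)"
    then have "k \<noteq> 0" using m(2) by auto
    then show ?thesis unfolding mk border_weight_xy_monomial by simp
  next
    assume mk: "m = xy_monomial k (n - 1 - j) j k"
    have "\<not> (n - 1 - j = 0 \<and> j = 0)" using assms by simp
    then show ?thesis unfolding mk border_weight_xy_monomial by auto
  qed
  ultimately show "border_weight n m < border_weight n (xy_monomial j 0 0 (n - 1 - j))" by simp
next
  fix j
  have "Poly_Mapping.lookup (xy_monomial j 0 0 (n - 1 - j)) (IX j 0) = 1" by (simp add: xy_monomial_def lookup_add lookup_single)
  then show "xy_monomial j 0 0 (n - 1 - j) \<noteq> 0" by (metis lookup_zero zero_neq_one)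
next
  fix i j assume "i < n" "j < n" "i \<noteq> j"
  then show "Poly_Mapping.keys (xy_monomial i 0 0 (n - 1 - i)) \<inter> Poly_Mapping.keys (xy_monomial j 0 0 (n - 1 - j)) = {}"
    by (auto simp: in_keys_iff xy_monomial_def lookup_add lookup_single when_def split: if_splits)
qed

text \<open>
The parameters are numbered so that all those belonging to \<open>X\<close> precede those belonging to \<open>Y\<close>. Column \<open>0\<close> of
\<open>X\<close> has no parameters, which explains the shift by one in \<open>b\<close>.
\<close>

definition x_rank :: "nat \<Rightarrow> nat \<Rightarrow> nat \<Rightarrow> nat" where
  "x_rank n a b = a * (n - 1) + (b - 1)"

definition y_rank :: "nat \<Rightarrow> nat \<Rightarrow> nat \<Rightarrow> nat" where
  "y_rank n a b = n * (n - 1) + (a * n + b)"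

definition par_x :: "nat \<Rightarrow> nat \<Rightarrow> nat \<Rightarrow> (nat \<Rightarrow>\<^sub>0 nat) \<Rightarrow>\<^sub>0 'k::field" where
  "par_x n a b = indet_poly (x_rank n a b)"

definition par_y :: "nat \<Rightarrow> nat \<Rightarrow> nat \<Rightarrow> (nat \<Rightarrow>\<^sub>0 nat) \<Rightarrow>\<^sub>0 'k::field" where
  "par_y n a b = indet_poly (y_rank n a b)"

text \<open>
The product of all pivots \<open>y 0 k\<close> of the triangular system except the one in column \<open>c\<close>. For \<open>c = 0\<close>, where
nothing is removed, it is the common denominator of the first \<open>n - 1\<close> equations.
\<close>

definition cofactor :: "nat \<Rightarrow> nat \<Rightarrow> (nat \<Rightarrow>\<^sub>0 nat) \<Rightarrow>\<^sub>0 'k::field" where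
  "cofactor n c = (\<Prod>k\<in>{1..<n} - {c}. par_y n 0 k)"

text \<open>
The pivot of the last equation: \<open>x (n - 1) 0\<close> occurs in \<open>f (n - 1)\<close> both with \<open>y 0 0\<close> and, from the subtracted sum, with
\<open>y (n - 1) (n - 1)\<close>.
\<close>

definition corner_diff :: "nat \<Rightarrow> (nat \<Rightarrow>\<^sub>0 nat) \<Rightarrow>\<^sub>0 'k::field" where
  "corner_diff n = par_y n 0 0 - par_y n (n - 1) (n - 1)"

text \<open>
For \<open>j < n - 1\<close>, the part of \<open>f j\<close> that does not involve column \<open>0\<close> of \<open>X\<close>.
\<close>

definition row_rest :: "nat \<Rightarrow> nat \<Rightarrow> (nat \<Rightarrow>\<^sub>0 nat) \<Rightarrow>\<^sub>0 'k::field" where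
  "row_rest n j = (\<Sum>k\<in>{1..<n}. par_x n j k * par_y n k (n - 1 - j))
     - (\<Sum>k<n. par_y n j k * par_x n k (n - 1 - j))"

text \<open>
Cramer's rule for the equations \<open>f j = 0\<close> in the unknowns \<open>x j 0\<close>. For \<open>j < n - 1\<close> the equation is
\<open>x j 0 * y 0 j' + row_rest n j = 0\<close>. The last one involves all unknowns, with pivot \<open>corner_diff n\<close>. The whole of \<open>X\<close>
is scaled by the product \<open>cofactor n 0 * corner_diff n\<close> of all pivots, so that the solution is polynomial. The
equations are homogeneous in \<open>X\<close>, hence they survive the scaling.
\<close>

fun parametrization :: "nat \<Rightarrow> indet \<Rightarrow> (nat \<Rightarrow>\<^sub>0 nat) \<Rightarrow>\<^sub>0 'k::field" where
  "parametrization n (IY a b) = par_y n a b"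
| "parametrization n (IX a b) =
    (if b \<noteq> 0 then cofactor n 0 * corner_diff n * par_x n a b
     else if a < n - 1 then - (cofactor n (n - 1 - a) * corner_diff n * row_rest n a)
     else - (\<Sum>k<n - 1. par_y n a k * cofactor n (n - 1 - k) * row_rest n k)
       - cofactor n 0 * (\<Sum>k\<in>{1..<n}. par_x n a k * par_y n k 0))"

lemma lessThan_eq_insert_0: "0 < n \<Longrightarrow> {..<n} = insert 0 {1..<n::nat}"
  by auto

lemma lessThan_eq_insert_last: "0 < n \<Longrightarrow> {..<n} = insert (n - 1) {..<n - 1 :: nat}"
  by auto

lemma parametrization_antidiag_entry:
  assumes "2 \<le> n" "j < n"
  shows "poly_subst (parametrization n) (antidiag_entry n j) = (0 :: (nat \<Rightarrow>\<^sub>0 nat) \<Rightarrow>\<^sub>0 'k::field)"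
proof -
  let ?\<phi> = "parametrization n :: indet \<Rightarrow> (nat \<Rightarrow>\<^sub>0 nat) \<Rightarrow>\<^sub>0 'k"
  let ?D = "cofactor n 0 :: (nat \<Rightarrow>\<^sub>0 nat) \<Rightarrow>\<^sub>0 'k" and ?e = "corner_diff n :: (nat \<Rightarrow>\<^sub>0 nat) \<Rightarrow>\<^sub>0 'k"
  let ?j' = "n - 1 - j"
  have "poly_subst ?\<phi> (antidiag_entry n j)
      = (\<Sum>k<n. ?\<phi> (IX j k) * par_y n k ?j') - (\<Sum>k<n. par_y n j k * ?\<phi> (IX k ?j'))"
    by (simp add: antidiag_entry_eq[OF assms(2)] del: parametrization.simps(2))
  also have "(\<Sum>k<n. ?\<phi> (IX j k) * par_y n k ?j') = ?\<phi> (IX j 0) * par_y n 0 ?j' + (\<Sum>k\<in>{1..<n}. ?\<phi> (IX j k) * par_y n k ?j')"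
    using assms by (subst lessThan_eq_insert_0) auto
  also have "(\<Sum>k\<in>{1..<n}. ?\<phi> (IX j k) * par_y n k ?j') = ?D * ?e * (\<Sum>k\<in>{1..<n}. par_x n j k * par_y n k ?j')"
    unfolding sum_distrib_left by (intro sum.cong) (auto simp: algebra_simps)
  finally have eq: "poly_subst ?\<phi> (antidiag_entry n j) = ?\<phi> (IX j 0) * par_y n 0 ?j'
      + ?D * ?e * (\<Sum>k\<in>{1..<n}. par_x n j k * par_y n k ?j') - (\<Sum>k<n. par_y n j k * ?\<phi> (IX k ?j'))" .
  show ?thesis
  proof (cases "j < n - 1")
    case True
    then have "(\<Sum>k<n. par_y n j k * ?\<phi> (IX k ?j')) = ?D * ?e * (\<Sum>k<n. par_y n j k * par_x n k ?j')"
      unfolding sum_distrib_left by (intro sum.cong) (auto simp: algebra_simps)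
    then have "poly_subst ?\<phi> (antidiag_entry n j) = ?\<phi> (IX j 0) * par_y n 0 ?j' + ?D * ?e * row_rest n j"
      unfolding eq row_rest_def by (simp add: algebra_simps)
    moreover have "?D = par_y n 0 ?j' * cofactor n ?j'"
    proof -
      have "?j' \<in> {1..<n}" using True by auto
      from prod.remove[OF _ this, of "par_y n 0"] show ?thesis by (simp add: cofactor_def)
    qed
    ultimately show ?thesis using True by (simp add: algebra_simps)
  next
    case False
    then have j: "j = n - 1" "?j' = 0" using assms by auto
    have "(\<Sum>k<n. par_y n j k * ?\<phi> (IX k 0)) = par_y n j (n - 1) * ?\<phi> (IX (n - 1) 0) + (\<Sum>k<n - 1. par_y n j k * ?\<phi> (IX k 0))"
      using assms by (subst lessThan_eq_insert_last) auto
    also have "(\<Sum>k<n - 1. par_y n j k * ?\<phi> (IX k 0)) = - (?e * (\<Sum>k<n - 1. par_y n j k * cofactor n (n - 1 - k) * row_rest n k))"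
      unfolding sum_distrib_left sum_negf[symmetric] by (intro sum.cong) (auto simp: algebra_simps)
    finally have "poly_subst ?\<phi> (antidiag_entry n j) = ?\<phi> (IX j 0) * ?e
      + ?D * ?e * (\<Sum>k\<in>{1..<n}. par_x n j k * par_y n k 0)
      + ?e * (\<Sum>k<n - 1. par_y n j k * cofactor n (n - 1 - k) * row_rest n k)"
      unfolding eq j(2) by (simp add: corner_diff_def algebra_simps j(1) del: parametrization.simps)
    also have "\<dots> = 0" using j(1) by (simp add: algebra_simps)
    finally show ?thesis .
  qed
qed

lemma indet_poly_eq_iff: "indet_poly v = (indet_poly w :: ('v \<Rightarrow>\<^sub>0 nat) \<Rightarrow>\<^sub>0 'k::field) \<longleftrightarrow> v = w"
proof
  assume "indet_poly v = (indet_poly w :: ('v \<Rightarrow>\<^sub>0 nat) \<Rightarrow>\<^sub>0 'k)"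
  then have "Poly_Mapping.keys (indet_poly v :: ('v \<Rightarrow>\<^sub>0 nat) \<Rightarrow>\<^sub>0 'k) = Poly_Mapping.keys (indet_poly w :: ('v \<Rightarrow>\<^sub>0 nat) \<Rightarrow>\<^sub>0 'k)"
    by simp
  then have "Poly_Mapping.single v (1::nat) = Poly_Mapping.single w 1" by (simp add: indet_poly_def)
  then have "Poly_Mapping.keys (Poly_Mapping.single v (1::nat)) = Poly_Mapping.keys (Poly_Mapping.single w (1::nat))" by simp
  then show "v = w" by simp
qed simp

lemma indet_poly_nonzero: "indet_poly v \<noteq> (0 :: ('v \<Rightarrow>\<^sub>0 nat) \<Rightarrow>\<^sub>0 'k::field)"
  by (metis indet_poly_def keys_single keys_zero insert_not_empty one_neq_zero)

text \<open>
The \<open>X\<close> parameters are set to zero first, while no \<open>Y\<close> parameter is zero yet: the scaling factor of \<open>X\<close> is then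
nonzero, so a free entry of \<open>X\<close> vanishes exactly when its own parameter is killed. After that the entries of \<open>Y\<close> are
the parameters themselves.
\<close>

lemma parametrization_generic:
  assumes "2 \<le> n" "i < n * (n - 1) + n * n"
  shows "\<exists>p\<in>carrier (mpoly_ring (indets n)).
    kill_below i (poly_subst (parametrization n) p) \<noteq> (0 :: (nat \<Rightarrow>\<^sub>0 nat) \<Rightarrow>\<^sub>0 'k::field) \<and>
    kill_below (Suc i) (poly_subst (parametrization n) p) = 0"
proof (cases "i < n * (n - 1)")
  case True
  define a b where "a = i div (n - 1)" and "b = Suc (i mod (n - 1))"
  have ab: "a < n" "b < n" "b \<noteq> 0" "x_rank n a b = i"
  proof -
    have "i mod (n - 1) < n - 1" using assms(1) by (intro mod_less_divisor) simp
    then show "b < n" by (simp add: b_def)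
    show "a < n" unfolding a_def by (rule less_mult_imp_div_less[OF True])
    show "x_rank n a b = i" by (simp only: x_rank_def a_def b_def diff_Suc_1 div_mult_mod_eq)
  qed (simp add: b_def)
  have y: "kill_below i (par_y n c d) = (par_y n c d :: (nat \<Rightarrow>\<^sub>0 nat) \<Rightarrow>\<^sub>0 'k)" for c d
    using True by (simp add: kill_below_def par_y_def y_rank_def)
  have D: "kill_below i (cofactor n 0) = (cofactor n 0 :: (nat \<Rightarrow>\<^sub>0 nat) \<Rightarrow>\<^sub>0 'k)"
    unfolding cofactor_def using y by (simp add: kill_below_def)
  have e: "kill_below i (corner_diff n) = (corner_diff n :: (nat \<Rightarrow>\<^sub>0 nat) \<Rightarrow>\<^sub>0 'k)"
    unfolding corner_diff_def using y by (simp add: kill_below_def)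
  have "cofactor n 0 \<noteq> (0 :: (nat \<Rightarrow>\<^sub>0 nat) \<Rightarrow>\<^sub>0 'k)"
    by (simp add: cofactor_def par_y_def indet_poly_nonzero)
  moreover have "corner_diff n \<noteq> (0 :: (nat \<Rightarrow>\<^sub>0 nat) \<Rightarrow>\<^sub>0 'k)"
    using assms(1) by (simp add: corner_diff_def par_y_def indet_poly_eq_iff y_rank_def)
  ultimately have "kill_below i (cofactor n 0 * corner_diff n * par_x n a b) \<noteq> (0 :: (nat \<Rightarrow>\<^sub>0 nat) \<Rightarrow>\<^sub>0 'k)"
    using D e by (simp add: kill_below_def par_x_def ab indet_poly_nonzero)
  moreover have "kill_below (Suc i) (cofactor n 0 * corner_diff n * par_x n a b) = (0 :: (nat \<Rightarrow>\<^sub>0 nat) \<Rightarrow>\<^sub>0 'k)"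
    by (simp add: kill_below_def par_x_def ab)
  moreover have "indet_poly (IX a b) \<in> carrier (mpoly_ring (indets n) :: ((indet \<Rightarrow>\<^sub>0 nat) \<Rightarrow>\<^sub>0 'k) ring)"
    using ab by (intro indet_poly_in_mpoly_ring) (auto simp: indets_def)
  ultimately show ?thesis using ab(3) by (intro bexI[of _ "indet_poly (IX a b)"]) auto
next
  case False
  define r where "r = i - n * (n - 1)"
  define a b where "a = r div n" and "b = r mod n"
  have r: "r < n * n" using False assms(2) by (simp add: r_def)
  have ab: "a < n" "b < n" using r less_mult_imp_div_less[of r n n] assms(1) by (auto simp: a_def b_def)
  have "y_rank n a b = i" using False by (simp add: y_rank_def a_def b_def r_def)
  then have "kill_below i (par_y n a b) \<noteq> (0 :: (nat \<Rightarrow>\<^sub>0 nat) \<Rightarrow>\<^sub>0 'k)"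
      "kill_below (Suc i) (par_y n a b) = (0 :: (nat \<Rightarrow>\<^sub>0 nat) \<Rightarrow>\<^sub>0 'k)"
    by (simp_all add: kill_below_def par_y_def indet_poly_nonzero)
  moreover have "indet_poly (IY a b) \<in> carrier (mpoly_ring (indets n) :: ((indet \<Rightarrow>\<^sub>0 nat) \<Rightarrow>\<^sub>0 'k) ring)"
    using ab by (intro indet_poly_in_mpoly_ring) (auto simp: indets_def)
  ultimately show ?thesis by (intro bexI[of _ "indet_poly (IY a b)"]) auto
qed

theorem theorem5p1:
  fixes n :: nat
  assumes "n \<ge> 3"
  defines "R \<equiv> (mpoly_ring (indets n) :: ((indet \<Rightarrow>\<^sub>0 nat) \<Rightarrow>\<^sub>0 'k::field) ring)"
    and "J \<equiv> (antidiag_ideal n :: ((indet \<Rightarrow>\<^sub>0 nat) \<Rightarrow>\<^sub>0 'k) set)"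
  shows "complete_intersection R J \<and> krull_dim (R Quot J) = ereal (real (2 * n\<^sup>2 - n))"
proof
  have n: "2 \<le> n" using assms(1) by simp
  let ?fs = "map (antidiag_entry n) [0..<n] :: ((indet \<Rightarrow>\<^sub>0 nat) \<Rightarrow>\<^sub>0 'k) list"
  have J: "J = genideal R (set ?fs)" unfolding J_def R_def by (rule antidiag_ideal_eq)
  have reg: "regular_sequence R ?fs"
    unfolding R_def by (rule coprime_leading_monomials.regular_sequence_leads[OF coprime_leading_antidiag[OF n]])
  show "complete_intersection R J" unfolding complete_intersection_def using reg J by blast
  interpret cring R unfolding R_def by (rule cring_mpoly_ring)
  have fs: "set ?fs \<subseteq> carrier R" using reg by (simp add: regular_sequence_def)
  let ?P = "\<lambda>i. {p \<in> carrier R. kill_below i (poly_subst (parametrization n) p) = 0}"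
  have chain: "prime_chain R (n * (n - 1) + n * n) ?P"
    unfolding R_def by (rule prime_chain_of_parametrization[OF parametrization_generic[OF n]])
  have "set ?fs \<subseteq> ?P 0"
  proof
    fix p assume "p \<in> set ?fs"
    then obtain j where "j < n" "p = antidiag_entry n j" by auto
    then have "poly_subst (parametrization n) p = 0" "p \<in> carrier R"
      by (simp_all only: parametrization_antidiag_entry[OF n] antidiag_entry_in_carrier R_def)
    then show "p \<in> ?P 0" by (simp add: kill_below_def)
  qed
  moreover have "primeideal (?P 0) R" using chain by (simp add: prime_chain_def)
  ultimately have J_sub: "J \<subseteq> ?P 0"
    unfolding J by (intro genideal_minimal primeideal.axioms(1))
  have J_ideal: "ideal J R" unfolding J by (rule genideal_ideal[OF fs])
  have dim: "2 * n\<^sup>2 - n = n * (n - 1) + n * n"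
    by (simp add: power2_eq_square diff_mult_distrib2)
  have "d \<le> n * (n - 1) + n * n" if "prime_chain R d P" "J \<subseteq> P 0" for d P
    using prime_chain_length_le[OF finite_indets reg[unfolded R_def] that(1)[unfolded R_def]]
      that(2) dim by (simp add: J R_def card_indets)
  then show "krull_dim (R Quot J) = ereal (real (2 * n\<^sup>2 - n))"
    unfolding dim by (rule krull_dim_Quot_eqI[OF is_cring J_ideal chain J_sub])
qed

end
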